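(* Let $S$ be the set of all $f \in \mathcal C(\{0,1\}^{\mathbb N})$ with the following property: for every $m \in \mathbb N$, there are a partition $\mathcal P$ of $\{0,1\}^{\mathbb N}$ of mesh $< 1/m$ and a multiple $q \in \mathbb N$ of $m$ such that every component of $\operatorname{Gr}(f,\mathcal P)$ is a balloon of type $(q!,q!)$ which is strict relative to $f$. Then $S$ is a comeager subset of $\mathcal C(\{0,1\}^{\mathbb N})$ such that any two of its elements are conjugate to each other, i.e. for all $f,g\in S$ there is a homeomorphism $h$ of $\{0,1\}^{\mathbb N}$ onto itself with $f=h^{-1}gh$.
   Context: $\mathbb N$ is the set of positive integers. $\{0,1\}^{\mathbb N}$ has the product topology and the metric $d(\sigma,\tau)=1/n$, where $n$ is the least positive integer with $\sigma(n)\neq\tau(n)$, and $d(\sigma,\sigma)=0$. $\mathcal C(\{0,1\}^{\mathbb N})$ is the space of all continuous maps from $\{0,1\}^{\mathbb N}$ to itself with the metric $\tilde d(f,g)=\max_{\sigma} d(f(\sigma),g(\sigma))$. A partition of $\{0,1\}^{\mathbb N}$ is a finite collection of nonempty pairwise disjoint clopen sets whose union is $\{0,1\}^{\mathbb N}$. Its mesh is the maximum of the diameters of its members. A digraph consists of a finite set of vertices and a set of directed edges between vertices (an edge from a vertex to itself is allowed). For a partition $\mathcal P$, $\operatorname{Gr}(f,\mathcal P)$ is the digraph with vertex set $\mathcal P$ in which $\overrightarrow{ab}$ is an edge if and only if $f(a)\cap b\neq\emptyset$. A component of a digraph is a largest (in vertices and edges) subgraph in which any two vertices are joined by a sequence of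 vertices such that consecutive ones are joined by an edge in at least one of the two directions. A balloon of type $(s,t)$ ($s,t\ge1$) is a digraph whose vertex set is the union of two disjoint sets $\{v_1,\dots,v_s\}$ and $\{w_1,\dots,w_t\}$ (of $s$ and $t$ distinct vertices, respectively), and whose edges are exactly $\overrightarrow{v_iv_{i+1}}$ ($1\le i<s$), $\overrightarrow{w_jw_{j+1}}$ ($1\le j<t$), $\overrightarrow{w_tw_1}$ and $\overrightarrow{v_sw_1}$. If a component $B$ of $\operatorname{Gr}(f,\mathcal P)$ is a balloon of type $(s,t)$ with vertices labeled $v_1,\dots,v_s,w_1,\dots,w_t$ so that its edges are exactly $\overrightarrow{v_iv_{i+1}}$ ($1\le i<s$), $\overrightarrow{w_jw_{j+1}}$ ($1\le j<t$), $\overrightarrow{w_tw_1}$ and $\overrightarrow{v_sw_1}$, then $B$ is strict relative to $f$ if $f(v_i)\subsetneq v_{i+1}$ for every $1\le i<s$, $f(w_j)\subsetneq w_{j+1}$ for every $1\le j<t$, and $f(v_s)\cup f(w_t)\subsetneq w_1$. *)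

theory Defs
  imports "HOL-Analysis.Analysis" "Graph_Theory.Digraph_Component"
begin

text \<open>
  The topology of \<^typ>\<open>nat \<Rightarrow> bool\<close> as an instance of \<^class>\<open>topological_space\<close> is the product
  of the discrete topologies. Coordinates are numbered from 0, so that coordinate \<open>n\<close> is the
  \<open>(n + 1)\<close>-st coordinate in the numbering by positive integers; this is the reason for the
  \<^const>\<open>Suc\<close> in the metric.
\<close>

type_synonym cantor = "nat \<Rightarrow> bool"

definition cantor_dist :: "cantor \<Rightarrow> cantor \<Rightarrow> real" where
  "cantor_dist x y = (if x = y then 0 else 1 / real (Suc (LEAST n. x n \<noteq> y n)))"

definition cantor_metric :: "cantor metric" where
  "cantor_metric = metric (UNIV, cantor_dist)"

definition cantor_maps :: "(cantor \<Rightarrow> cantor) metric" where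
  "cantor_maps = cfunspace euclidean cantor_metric"

lemma cantor_dist_less_iff: "cantor_dist x y < 1 / real (Suc n) \<longleftrightarrow> (\<forall>i\<le>n. x i = y i)"
proof (cases "x = y")
  case False
  define k where "k = (LEAST n. x n \<noteq> y n)"
  obtain m where "x m \<noteq> y m" using False by auto
  then have k: "x k \<noteq> y k" unfolding k_def by (rule LeastI)
  have below: "x i = y i" if "i < k" for i
    using that not_less_Least unfolding k_def by blast
  have "cantor_dist x y < 1 / real (Suc n) \<longleftrightarrow> n < k"
    unfolding cantor_dist_def k_def[symmetric] using False by (simp add: field_simps)
  also have "\<dots> \<longleftrightarrow> (\<forall>i\<le>n. x i = y i)"
    using k below by (meson le_less_trans not_less)
  finally show ?thesis .
qed (auto simp: cantor_dist_def)

lemma cantor_dist_commute: "cantor_dist x y = cantor_dist y x"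
  by (simp add: cantor_dist_def eq_commute)

lemma cantor_dist_ultra: "cantor_dist x z \<le> max (cantor_dist x y) (cantor_dist y z)"
proof (rule ccontr)
  assume *: "\<not> ?thesis"
  have "0 \<le> cantor_dist x y" by (simp add: cantor_dist_def)
  with * have "x \<noteq> z" by (auto simp: cantor_dist_def[of z z])
  define n where "n = (LEAST n. x n \<noteq> z n)"
  have d: "cantor_dist x z = 1 / real (Suc n)"
    using \<open>x \<noteq> z\<close> by (simp add: cantor_dist_def n_def)
  have "cantor_dist x y < 1 / real (Suc n)" "cantor_dist y z < 1 / real (Suc n)"
    using * by (auto simp: d)
  then have "\<forall>i\<le>n. x i = z i" by (simp del: of_nat_Suc add: cantor_dist_less_iff)
  then have "cantor_dist x z < 1 / real (Suc n)" by (simp only: cantor_dist_less_iff)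
  then show False by (simp add: d)
qed

interpretation Cantor: Metric_space UNIV cantor_dist
proof
  show nonneg: "0 \<le> cantor_dist x y" for x y by (simp add: cantor_dist_def)
  show "cantor_dist x y = cantor_dist y x" for x y by (rule cantor_dist_commute)
  show "cantor_dist x y = 0 \<longleftrightarrow> x = y" for x y by (simp add: cantor_dist_def)
  show "cantor_dist x z \<le> cantor_dist x y + cantor_dist y z" for x y z
    using cantor_dist_ultra[of x z y] nonneg[of x y] nonneg[of y z] by linarith
qed

lemma mspace_cantor_metric [simp]: "mspace cantor_metric = UNIV"
  and mdist_cantor_metric [simp]: "mdist cantor_metric = cantor_dist"
  by (simp_all add: cantor_metric_def)

lemma cantor_dist_le_1: "cantor_dist x y \<le> 1"
  by (simp add: cantor_dist_def)

lemma open_cantor_iff: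
  fixes U :: "cantor set"
  shows "open U \<longleftrightarrow> (\<forall>x\<in>U. \<exists>n. {y. \<forall>i\<le>n. y i = x i} \<subseteq> U)"
proof (intro iffI ballI)
  fix x assume "open U" "x \<in> U"
  then obtain X where X: "x \<in> (\<Pi>\<^sub>E i\<in>UNIV. X i)" "finite {i. X i \<noteq> UNIV}"
      "(\<Pi>\<^sub>E i\<in>UNIV. X i) \<subseteq> U"
    using product_topology_open_contains_basis[of "\<lambda>_. euclidean" UNIV U x]
    by (auto simp: open_fun_def)
  define n where "n = Max (insert 0 {i. X i \<noteq> UNIV})"
  have le: "i \<le> n" if "X i \<noteq> UNIV" for i
    using X(2) that by (simp add: n_def)
  have "{y. \<forall>i\<le>n. y i = x i} \<subseteq> (\<Pi>\<^sub>E i\<in>UNIV. X i)"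
  proof (clarsimp simp: PiE_def Pi_def)
    fix y i assume "\<forall>i\<le>n. y i = x i"
    then show "y i \<in> X i" using le[of i] X(1) by (cases "X i = UNIV") auto
  qed
  from this X(3) have "{y. \<forall>i\<le>n. y i = x i} \<subseteq> U" by (rule subset_trans)
  then show "\<exists>n. {y. \<forall>i\<le>n. y i = x i} \<subseteq> U" by (rule exI)
next
  assume *: "\<forall>x\<in>U. \<exists>n. {y. \<forall>i\<le>n. y i = x i} \<subseteq> U"
  have cyl: "open {y :: cantor. \<forall>i\<le>n. y i = x i}" for n x
  proof -
    have "open {y :: cantor. y i = x i}" for i
    proof -
      have "open ((\<lambda>y :: cantor. y i) -` {x i})"
        by (intro open_vimage open_discrete continuous_on_product_coordinates)
      then show ?thesis by (simp add: vimage_def)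
    qed
    then have "open (\<Inter>i\<in>{..n}. {y :: cantor. y i = x i})" by blast
    also have "(\<Inter>i\<in>{..n}. {y :: cantor. y i = x i}) = {y. \<forall>i\<le>n. y i = x i}" by auto
    finally show ?thesis .
  qed
  show "open U"
  proof (subst open_subopen, rule ballI)
    fix x assume "x \<in> U"
    with * have "\<exists>n. {y. \<forall>i\<le>n. y i = x i} \<subseteq> U" by (rule bspec)
    then obtain n where n: "{y. \<forall>i\<le>n. y i = x i} \<subseteq> U" ..
    have "x \<in> {y. \<forall>i\<le>n. y i = x i}" by simp
    with cyl[of n x] n show "\<exists>T. open T \<and> x \<in> T \<and> T \<subseteq> U" by (intro exI conjI)
  qed
qed

lemma mtopology_of_cantor_metric [simp]: "mtopology_of cantor_metric = euclidean"
proof -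
  have "openin Cantor.mtopology U \<longleftrightarrow> open U" for U
  proof -
    have "(\<exists>r>0. Cantor.mball x r \<subseteq> U) \<longleftrightarrow> (\<exists>n. {y. \<forall>i\<le>n. y i = x i} \<subseteq> U)" for x
    proof
      assume "\<exists>r>0. Cantor.mball x r \<subseteq> U"
      then obtain r where r: "r > 0" "Cantor.mball x r \<subseteq> U" by (elim exE conjE)
      from nat_approx_posE[OF r(1)] obtain n where n: "1 / real (Suc n) < r" .
      have "{y. \<forall>i\<le>n. y i = x i} \<subseteq> Cantor.mball x r"
      proof clarsimp
        fix y assume "\<forall>i\<le>n. y i = x i"
        then have "cantor_dist x y < 1 / real (Suc n)" by (simp only: cantor_dist_less_iff) simp
        then show "cantor_dist x y < r" using n by linarith
      qed
      from this r(2) have "{y. \<forall>i\<le>n. y i = x i} \<subseteq> U" by (rule subset_trans)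
      then show "\<exists>n. {y. \<forall>i\<le>n. y i = x i} \<subseteq> U" by (rule exI)
    next
      assume "\<exists>n. {y. \<forall>i\<le>n. y i = x i} \<subseteq> U"
      then obtain n where n: "{y. \<forall>i\<le>n. y i = x i} \<subseteq> U" ..
      have "Cantor.mball x (1 / real (Suc n)) = {y. \<forall>i\<le>n. y i = x i}"
        by (auto simp: cantor_dist_less_iff simp del: of_nat_Suc)
      then show "\<exists>r>0. Cantor.mball x r \<subseteq> U"
        using n by (intro exI[of _ "1 / real (Suc n)"]) (simp del: of_nat_Suc)
    qed
    then show ?thesis unfolding Cantor.openin_mtopology open_cantor_iff Ball_def by simp
  qed
  then show ?thesis unfolding cantor_metric_def Cantor.mtopology_of topology_eq by simp
qed

lemma cantor_mbounded: "Cantor.mbounded A"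
  unfolding Cantor.mbounded_alt using cantor_dist_le_1 by blast

lemma mspace_cantor_maps: "mspace cantor_maps = {f. continuous_on UNIV f}"
  using cantor_mbounded by (auto simp: cantor_maps_def)

lemma mdist_cantor_maps:
  "mdist cantor_maps f g = (SUP x. cantor_dist (f x) (g x))"
proof -
  have "Cantor.fdist UNIV f g = (SUP x. cantor_dist (f x) (g x))"
    using cantor_mbounded by (simp add: Cantor.fdist_def Cantor.fspace_def)
  moreover have "mdist cantor_maps = Cantor.fdist UNIV"
    unfolding cantor_maps_def mdist_cfunspace_eq_mdist_funspace funspace_def
    using Metric_space.mdist_metric[OF Cantor.Metric_space_funspace] by simp
  ultimately show ?thesis by simp
qed

definition nowhere_dense_in :: "'a topology \<Rightarrow> 'a set \<Rightarrow> bool" where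
  "nowhere_dense_in X A \<longleftrightarrow> A \<subseteq> topspace X \<and> X interior_of (X closure_of A) = {}"

definition meager_in :: "'a topology \<Rightarrow> 'a set \<Rightarrow> bool" where
  "meager_in X A \<longleftrightarrow> (\<exists>\<F>. countable \<F> \<and> (\<forall>F\<in>\<F>. nowhere_dense_in X F) \<and> A = \<Union>\<F>)"

definition comeager_in :: "'a topology \<Rightarrow> 'a set \<Rightarrow> bool" where
  "comeager_in X A \<longleftrightarrow> A \<subseteq> topspace X \<and> meager_in X (topspace X - A)"

definition cantor_diameter :: "cantor set \<Rightarrow> real" where
  "cantor_diameter A = (if A = {} then 0 else SUP (x, y)\<in>A \<times> A. cantor_dist x y)"

definition clopen_partition :: "cantor set set \<Rightarrow> bool" where
  "clopen_partition P \<longleftrightarrow>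
     finite P \<and> {} \<notin> P \<and> disjoint P \<and> (\<forall>a\<in>P. open a \<and> closed a) \<and> \<Union>P = UNIV"

definition mesh :: "cantor set set \<Rightarrow> real" where
  "mesh P = Max (cantor_diameter ` P)"

definition Gr :: "(cantor \<Rightarrow> cantor) \<Rightarrow> cantor set set \<Rightarrow> cantor set pair_pre_digraph" where
  "Gr f P = \<lparr>pverts = P, parcs = {(a, b). a \<in> P \<and> b \<in> P \<and> f ` a \<inter> b \<noteq> {}}\<rparr>"

text \<open>
  \<^const>\<open>Digraph_Component.connected\<close> is connectedness of the underlying undirected graph.
\<close>

definition digraph_component :: "'a pair_pre_digraph \<Rightarrow> 'a pair_pre_digraph \<Rightarrow> bool" where
  "digraph_component G B \<longleftrightarrow>
     pre_digraph.max_subgraph (with_proj G) Digraph_Component.connected (with_proj B)"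

text \<open>Restricting to components of the form \<^term>\<open>with_proj B\<close> loses none.\<close>

lemma max_subgraph_with_proj:
  assumes "pre_digraph.max_subgraph (with_proj G) Q H"
  shows "\<exists>B. H = with_proj B"
proof -
  have "tail H = fst" "head H = snd"
    using assms by (auto simp: pre_digraph.max_subgraph_def subgraph_def compatible_def)
  then have "H = with_proj \<lparr>pverts = verts H, parcs = arcs H\<rparr>"
    by (simp add: with_proj_def)
  then show ?thesis ..
qed

text \<open>Only the values of \<open>v\<close> on \<open>{1..s}\<close> and of \<open>w\<close> on \<open>{1..t}\<close> matter.\<close>

definition balloon_labelling ::
    "nat \<Rightarrow> nat \<Rightarrow> (nat \<Rightarrow> 'a) \<Rightarrow> (nat \<Rightarrow> 'a) \<Rightarrow> 'a pair_pre_digraph \<Rightarrow> bool" where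
  "balloon_labelling s t v w B \<longleftrightarrow>
     1 \<le> s \<and> 1 \<le> t \<and> inj_on v {1..s} \<and> inj_on w {1..t} \<and> v ` {1..s} \<inter> w ` {1..t} = {} \<and>
     pverts B = v ` {1..s} \<union> w ` {1..t} \<and>
     parcs B = {(v i, v (i + 1)) | i. 1 \<le> i \<and> i < s} \<union> {(w j, w (j + 1)) | j. 1 \<le> j \<and> j < t}
               \<union> {(w t, w 1), (v s, w 1)}"

definition balloon :: "nat \<Rightarrow> nat \<Rightarrow> 'a pair_pre_digraph \<Rightarrow> bool" where
  "balloon s t B \<longleftrightarrow> (\<exists>v w. balloon_labelling s t v w B)"

text \<open>
  A balloon determines \<open>s\<close>, \<open>t\<close> and its labelling (the \<open>w\<^sub>j\<close> form its only cycle, and the \<open>v\<^sub>i\<close>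
  the path that leads into it), so the existential quantifier here amounts to a universal one.
\<close>

definition strict_balloon :: "(cantor \<Rightarrow> cantor) \<Rightarrow> cantor set pair_pre_digraph \<Rightarrow> bool" where
  "strict_balloon f B \<longleftrightarrow>
     (\<exists>s t v w. balloon_labelling s t v w B \<and>
        (\<forall>i. 1 \<le> i \<and> i < s \<longrightarrow> f ` v i \<subset> v (i + 1)) \<and>
        (\<forall>j. 1 \<le> j \<and> j < t \<longrightarrow> f ` w j \<subset> w (j + 1)) \<and>
        f ` v s \<union> f ` w t \<subset> w 1)"

definition strict_balloon_maps :: "(cantor \<Rightarrow> cantor) set" where
  "strict_balloon_maps =
     {f \<in> mspace cantor_maps. \<forall>m\<ge>1. \<exists>P q. clopen_partition P \<and> mesh P < 1 / real m \<and>
        q \<ge> 1 \<and> m dvd q \<and>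
        (\<forall>B. digraph_component (Gr f P) B \<longrightarrow>
           balloon (fact q) (fact q) B \<and> strict_balloon f B)}"

end

theory Submission
  imports Defs
begin

text \<open>
  The point is to replace digraphs by symbolic codings. A partition whose components are balloons
  of one type \<open>(s, t)\<close> amounts to a locally constant map \<open>p\<close> that sends each point to a pair (name of
  a component, position in it), where positions run through \<open>{..<s + t}\<close>: first along the path, then
  around the cycle. That the edges are exactly those of balloons means \<open>p \<circ> f = step \<circ> p\<close>, where
  \<open>step\<close> advances the position; strictness means that every fibre of \<open>p\<close> contains a point outside
  the range of \<open>f\<close> (\<open>balloon_coding\<close>, \<open>fibres_components\<close>, \<open>partition_imp_coding\<close>).

  Genericity. A fixed \<open>p\<close> still codes every map near \<open>f\<close>, because \<open>p\<close> is locally constant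
  and a compact range stays away from finitely many points outside it (\<open>openness_at_scale\<close>). For
  density, approximate \<open>f\<close> by a self-map \<open>\<psi>\<close> of the finite set of long cylinders. Every orbit of
  \<open>\<psi>\<close> runs into a cycle, and once \<open>q\<close> is at least the number of cylinders, the orbit is periodic
  from time \<open>q!\<close> on with a period that divides \<open>q!\<close>; so it is traced by a balloon of type
  \<open>(q!, q!)\<close>. Since cylinders can be cut into as many pieces as needed, all these balloons fit in at
  once, disjointly, and a map that is constant on each piece makes them strict
  (\<open>density_at_scale\<close>). The set in question is the intersection over all scales.

  Conjugacy. Codings of two maps by the same positions are refined alternately. The
  combinatorics of a refinement is simple: a balloon mapped into a coarser one is determined by the
  place where its path starts, since everything else is iteration of \<open>step\<close>. Strictness forces
  every vertex of the coarse coding to be such a starting place, arbitrarily often if the fine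
  partition is fine enough, because a member so small that it avoids the range of \<open>f\<close> can only
  be the first vertex of a path (\<open>refine_coding\<close>). Hence, given a fine coding for
  \<open>f\<close>, one takes a coding for \<open>g\<close> with enough balloons over each starting place, wraps the longer
  balloons (of type \<open>(q'!, q'!)\<close> with \<open>q\<close> dividing \<open>q'\<close>) onto those of type \<open>(q!, q!)\<close>, and
  merges surplus ones; neither operation destroys strictness. The result is a coding for \<open>g\<close> that
  is combinatorially identical to the fine coding for \<open>f\<close> (\<open>extend_codings\<close>). In the limit,
  points with the same names at all stages correspond under a conjugating homeomorphism
  (\<open>limit_of_codings\<close>).
\<close>

section \<open>Finite agreement of binary sequences\<close>

text \<open>
  Nearness in the Cantor space, and later uniform nearness of maps, is measured throughout by the
  number of initial coordinates on which two sequences agree; being within \<open>1 / m\<close> of each other is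
  agreement on the first \<open>m\<close> coordinates.
\<close>

definition agree :: "nat \<Rightarrow> cantor \<Rightarrow> cantor \<Rightarrow> bool" where
  "agree n x y \<longleftrightarrow> (\<forall>i<n. x i = y i)"

lemma agree_refl [simp]: "agree n x x"
  and agree_sym: "agree n x y \<Longrightarrow> agree n y x"
  and agree_trans: "agree n x y \<Longrightarrow> agree n y z \<Longrightarrow> agree n x z"
  and agree_mono: "agree n x y \<Longrightarrow> k \<le> n \<Longrightarrow> agree k x y"
  by (auto simp: agree_def)

lemma agree_all_imp_eq: "(\<And>n. agree n x y) \<Longrightarrow> x = y"
proof
  fix i assume "\<And>n. agree n x y"
  from this[of "Suc i"] show "x i = y i" by (simp add: agree_def)
qed

lemma cantor_dist_less_iff_agree: "1 \<le> m \<Longrightarrow> cantor_dist x y < 1 / real m \<longleftrightarrow> agree m x y"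
  using cantor_dist_less_iff[of x y "m - 1"] by (auto simp: agree_def simp flip: less_Suc_eq_le)

lemma agree_imp_cantor_dist_le:
  assumes "agree m x y"
  shows "cantor_dist x y \<le> 1 / real (Suc m)"
proof (cases "x = y")
  case False
  define k where "k = (LEAST n. x n \<noteq> y n)"
  have "\<exists>n. x n \<noteq> y n" using False by auto
  then have "x k \<noteq> y k" unfolding k_def by (rule LeastI_ex)
  then have "m \<le> k" using assms not_le_imp_less unfolding agree_def by blast
  moreover have "cantor_dist x y = 1 / real (Suc k)"
    using False by (simp only: cantor_dist_def k_def if_False)
  ultimately show ?thesis by (simp only:) (intro divide_left_mono, auto)
qed (simp add: cantor_dist_def)

lemma open_iff_agree: "open U \<longleftrightarrow> (\<forall>x\<in>U. \<exists>n. \<forall>y. agree n x y \<longrightarrow> y \<in> U)" for U :: "cantor set"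
proof -
  have "(\<exists>n. {y. \<forall>i\<le>n. y i = x i} \<subseteq> U) \<longleftrightarrow> (\<exists>n. \<forall>y. agree n x y \<longrightarrow> y \<in> U)" for x
  proof
    assume "\<exists>n. {y. \<forall>i\<le>n. y i = x i} \<subseteq> U"
    then obtain n where "{y. \<forall>i\<le>n. y i = x i} \<subseteq> U" ..
    then have "\<forall>y. agree (Suc n) x y \<longrightarrow> y \<in> U" by (force simp: agree_def less_Suc_eq_le)
    then show "\<exists>n. \<forall>y. agree n x y \<longrightarrow> y \<in> U" ..
  next
    assume "\<exists>n. \<forall>y. agree n x y \<longrightarrow> y \<in> U"
    then obtain n where "\<forall>y. agree n x y \<longrightarrow> y \<in> U" ..
    then have "{y. \<forall>i\<le>n. y i = x i} \<subseteq> U" by (auto simp: agree_def)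
    then show "\<exists>n. {y. \<forall>i\<le>n. y i = x i} \<subseteq> U" ..
  qed
  then show ?thesis unfolding open_cantor_iff by simp
qed

lemma compact_cantor: "compact (UNIV :: cantor set)"
proof -
  have "compact_space (euclidean :: bool topology)"
    by (simp add: compact_space_def finite_imp_compact)
  then have "compact_space (product_topology (\<lambda>i::nat. euclidean :: bool topology) UNIV)"
    by (simp only: compact_space_product_topology) blast
  then show ?thesis
    by (simp only: euclidean_product_topology compact_space_def topspace_euclidean
        compactin_euclidean_iff)
qed

text \<open>
  By compactness, a map with open fibres is determined by finitely many coordinates; this uniform
  form is taken as the definition.
\<close>

definition locally_constant :: "(cantor \<Rightarrow> 'a) \<Rightarrow> bool" where
  "locally_constant p \<longleftrightarrow> (\<exists>n. \<forall>x y. agree n x y \<longrightarrow> p x = p y)"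

lemma locally_constantI:
  assumes "\<And>d. open (p -` {d})"
  shows "locally_constant p"
proof -
  have "\<exists>n. \<forall>y. agree n x y \<longrightarrow> p y = p x" for x
    using assms[of "p x"] unfolding open_iff_agree by simp
  then obtain N where N: "\<And>x y. agree (N x) x y \<Longrightarrow> p y = p x" by metis
  have op: "open {y. agree (N x) x y}" for x
    unfolding open_iff_agree by (auto intro: agree_trans)
  have "compact (UNIV :: cantor set)" by (rule compact_cantor)
  then obtain F where F: "finite F" "UNIV = (\<Union>x\<in>F. {y. agree (N x) x y})"
  proof (rule compactE_image[where C = UNIV and f = "\<lambda>x. {y. agree (N x) x y}"])
    show "UNIV \<subseteq> (\<Union>x. {y. agree (N x) x y})"
      using agree_refl by blast
  qed (use op in auto)
  have "p x = p y" if "agree (Max (N ` F)) x y" for x y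
  proof -
    obtain z where z: "z \<in> F" "agree (N z) z x" using F(2) by blast
    have "agree (N z) x y" using that z(1) F(1) by (auto intro: agree_mono)
    then have "agree (N z) z y" using z(2) by (rule agree_trans[rotated])
    then show ?thesis using N z(2) by metis
  qed
  then show ?thesis unfolding locally_constant_def by blast
qed

lemma open_fibre: "locally_constant p \<Longrightarrow> open (p -` D)"
  unfolding locally_constant_def open_iff_agree by (auto) metis

lemma closed_fibre: "locally_constant p \<Longrightarrow> closed (p -` D)"
  using open_fibre[of p "- D"] by (simp add: closed_def vimage_Compl)

lemma locally_constant_comp: "locally_constant p \<Longrightarrow> locally_constant (\<lambda>x. \<theta> (p x))"
  unfolding locally_constant_def by metis

lemma continuous_iff_agree:
  "continuous_on UNIV f \<longleftrightarrow> (\<forall>n. \<exists>k. \<forall>x y. agree k x y \<longrightarrow> agree n (f x) (f y))"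
  for f :: "cantor \<Rightarrow> cantor"
proof
  assume c: "continuous_on UNIV f"
  show "\<forall>n. \<exists>k. \<forall>x y. agree k x y \<longrightarrow> agree n (f x) (f y)"
  proof
    fix n
    have "locally_constant (\<lambda>x. {z. agree n (f x) z})"
    proof (rule locally_constantI)
      fix d
      have eq: "{z. agree n w z} = {z. agree n w' z}" if "agree n w w'" for w w'
        using that by (auto intro: agree_trans agree_sym)
      have "open {w. {z. agree n w z} = d}"
        unfolding open_iff_agree using eq by blast
      then have "open (f -` {w. {z. agree n w z} = d})"
        by (rule open_vimage[OF _ c])
      then show "open ((\<lambda>x. {z. agree n (f x) z}) -` {d})" by (simp add: vimage_def)
    qed
    then show "\<exists>k. \<forall>x y. agree k x y \<longrightarrow> agree n (f x) (f y)"
      unfolding locally_constant_def by (metis agree_refl mem_Collect_eq)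
  qed
next
  assume *: "\<forall>n. \<exists>k. \<forall>x y. agree k x y \<longrightarrow> agree n (f x) (f y)"
  show "continuous_on UNIV f"
    unfolding continuous_on_open_vimage[OF open_UNIV]
  proof (intro allI impI)
    fix B :: "cantor set" assume "open B"
    then have "\<forall>x\<in>f -` B. \<exists>k. \<forall>y. agree k x y \<longrightarrow> y \<in> f -` B"
      using * unfolding open_iff_agree by (metis vimage_eq)
    then show "open (f -` B \<inter> UNIV)" by (simp add: open_iff_agree)
  qed
qed

text \<open>
  The range of a continuous map is compact, hence closed, so a point outside it has a whole
  neighbourhood outside it.
\<close>

lemma outside_range_gap:
  fixes f :: "cantor \<Rightarrow> cantor"
  assumes "continuous_on UNIV f" "x \<notin> range f"
  obtains n where "\<And>z. agree n x z \<Longrightarrow> z \<notin> range f"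
proof -
  have "closed (range f)"
  proof -
    have "Hausdorff_space (euclidean :: cantor topology)"
      using Cantor.Hausdorff_space_mtopology mtopology_of_cantor_metric
      by (simp add: cantor_metric_def Cantor.mtopology_of)
    moreover have "compact (range f)"
      by (rule compact_continuous_image[OF assms(1) compact_cantor])
    ultimately show ?thesis
      using compactin_imp_closedin[of euclidean "range f"] by simp
  qed
  then have "open (- range f)" by (simp add: open_Compl)
  then show ?thesis using assms(2) that unfolding open_iff_agree by (metis ComplD ComplI)
qed

lemma open_infinite:
  fixes U :: "cantor set"
  assumes "open U" "U \<noteq> {}"
  shows "infinite U"
proof -
  obtain x n where xn: "\<And>y. agree n x y \<Longrightarrow> y \<in> U"
    using assms unfolding open_iff_agree by blast
  have "inj_on (\<lambda>k. x(k := \<not> x k)) {n..}"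
    by (rule inj_onI) (metis fun_upd_apply)
  then have "infinite ((\<lambda>k. x(k := \<not> x k)) ` {n..})"
    using finite_image_iff infinite_Ici by blast
  moreover have "(\<lambda>k. x(k := \<not> x k)) ` {n..} \<subseteq> U"
    by (auto intro!: xn simp: agree_def)
  ultimately show ?thesis using finite_subset by blast
qed

text \<open>
  A fine enough partition puts finitely many given points into different members.
\<close>

lemma separate_finite:
  assumes "finite F"
  obtains n where "\<And>x y. x \<in> F \<Longrightarrow> y \<in> F \<Longrightarrow> agree n x y \<Longrightarrow> x = y"
proof -
  have "\<exists>n. \<forall>x\<in>F. \<forall>y\<in>F. agree n x y \<longrightarrow> x = y" if "finite F"
    using that
  proof (induction F)
    case (insert z F)
    then obtain n where n: "\<forall>x\<in>F. \<forall>y\<in>F. agree n x y \<longrightarrow> x = y" by blast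
    have "\<exists>k. \<forall>k'\<ge>k. \<not> agree k' z x" if "x \<in> F" for x
      using that insert.hyps(2) by (metis agree_all_imp_eq agree_mono)
    then obtain K where K: "\<And>x k'. x \<in> F \<Longrightarrow> k' \<ge> K x \<Longrightarrow> \<not> agree k' z x" by metis
    define k where "k = Max (insert n (K ` F))"
    have kn: "n \<le> k" "\<And>x. x \<in> F \<Longrightarrow> K x \<le> k"
      using insert.hyps by (auto simp: k_def)
    have "x = y" if "x \<in> insert z F" "y \<in> insert z F" "agree k x y" for x y
    proof (cases "x = z \<or> y = z")
      case True then show ?thesis using that kn K by (metis agree_sym insertE)
    next
      case False then show ?thesis using that n kn agree_mono by (metis insertE)
    qed
    then show ?case by blast
  qed auto
  then show ?thesis using assms that by blast
qed

text \<open>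
  The metric takes only the values \<open>0\<close> and \<open>1 / n\<close>, so the strict bound on all distances leaves
  room for the supremum.
\<close>

lemma cantor_diameter_less_iff:
  assumes "A \<noteq> {}" "1 \<le> m"
  shows "cantor_diameter A < 1 / real m \<longleftrightarrow> (\<forall>x\<in>A. \<forall>y\<in>A. agree m x y)"
proof
  have bdd: "bdd_above ((\<lambda>(x, y). cantor_dist x y) ` (A \<times> A))"
    by (rule bdd_aboveI[where M = 1]) (auto simp: cantor_dist_le_1)
  assume "cantor_diameter A < 1 / real m"
  then have "cantor_dist x y < 1 / real m" if "x \<in> A" "y \<in> A" for x y
    using cSUP_upper[OF _ bdd, of "(x, y)"] that assms by (auto simp: cantor_diameter_def)
  then show "\<forall>x\<in>A. \<forall>y\<in>A. agree m x y"
    using cantor_dist_less_iff_agree[OF assms(2)] by simp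
next
  assume *: "\<forall>x\<in>A. \<forall>y\<in>A. agree m x y"
  then have "cantor_dist x y \<le> 1 / real (Suc m)" if "x \<in> A" "y \<in> A" for x y
    using that agree_imp_cantor_dist_le by blast
  then have "(SUP (x, y)\<in>A \<times> A. cantor_dist x y) \<le> 1 / real (Suc m)"
    using assms by (intro cSUP_least) auto
  also have "\<dots> < 1 / real m" using assms by (simp add: field_simps)
  finally show "cantor_diameter A < 1 / real m" using assms by (simp add: cantor_diameter_def)
qed

lemma mesh_less_iff:
  assumes "clopen_partition P" "1 \<le> m"
  shows "mesh P < 1 / real m \<longleftrightarrow> (\<forall>a\<in>P. \<forall>x\<in>a. \<forall>y\<in>a. agree m x y)"
proof -
  have "finite P" "P \<noteq> {}" "{} \<notin> P" using assms(1) by (auto simp: clopen_partition_def)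
  then have "mesh P < 1 / real m \<longleftrightarrow> (\<forall>a\<in>P. cantor_diameter a < 1 / real m)"
    by (simp add: mesh_def)
  also have "\<dots> \<longleftrightarrow> (\<forall>a\<in>P. \<forall>x\<in>a. \<forall>y\<in>a. agree m x y)"
    using cantor_diameter_less_iff[OF _ assms(2)] \<open>{} \<notin> P\<close> by (metis (no_types, lifting))
  finally show ?thesis .
qed

lemma cantor_maps_dist_less:
  assumes "\<And>x. agree (Suc n) (f x) (g x)"
  shows "mdist cantor_maps f g < 1 / real (Suc n)"
proof -
  have "cantor_dist (f x) (g x) \<le> 1 / real (Suc (Suc n))" for x
    using assms by (rule agree_imp_cantor_dist_le)
  then have "mdist cantor_maps f g \<le> 1 / real (Suc (Suc n))"
    unfolding mdist_cantor_maps by (intro cSUP_least) auto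
  also have "\<dots> < 1 / real (Suc n)" by (simp add: field_simps)
  finally show ?thesis .
qed

lemma cantor_maps_dist_lessD:
  assumes "mdist cantor_maps f g < 1 / real (Suc n)"
  shows "agree (Suc n) (f x) (g x)"
proof -
  have "bdd_above (range (\<lambda>x. cantor_dist (f x) (g x)))"
    by (rule bdd_aboveI[where M = 1]) (auto simp: cantor_dist_le_1)
  then have "cantor_dist (f x) (g x) \<le> mdist cantor_maps f g"
    unfolding mdist_cantor_maps by (intro cSUP_upper) auto
  with assms have "cantor_dist (f x) (g x) < 1 / real (Suc n)" by simp
  then show ?thesis by (subst (asm) cantor_dist_less_iff_agree) auto
qed

section \<open>Components as undirected reachability classes\<close>

definition induced_on :: "'a pair_pre_digraph \<Rightarrow> 'a set \<Rightarrow> 'a pair_pre_digraph" where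
  "induced_on G V = \<lparr>pverts = V, parcs = parcs G \<inter> V \<times> V\<rparr>"

definition weak_class :: "'a pair_pre_digraph \<Rightarrow> 'a \<Rightarrow> 'a set" where
  "weak_class G a = {b. (a, b) \<in> (parcs G \<union> (parcs G)\<inverse>)\<^sup>*}"

lemma connected_with_proj_iff:
  assumes "pair_wf_digraph B"
  shows "Digraph_Component.connected (with_proj B) \<longleftrightarrow>
    pverts B \<noteq> {} \<and> (\<forall>u\<in>pverts B. \<forall>v\<in>pverts B. (u, v) \<in> (parcs B \<union> (parcs B)\<inverse>)\<^sup>*)"
proof -
  interpret pair_wf_digraph B by fact
  have s: "(parcs B)\<^sup>s = parcs B \<union> (parcs B)\<inverse>" by (auto simp: symcl_def)
  have "(u, v) \<in> rtrancl_on (pverts B) (parcs B \<union> (parcs B)\<inverse>) \<longleftrightarrow>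
      (u, v) \<in> (parcs B \<union> (parcs B)\<inverse>)\<^sup>*" if "u \<in> pverts B" for u v
  proof
    assume "(u, v) \<in> (parcs B \<union> (parcs B)\<inverse>)\<^sup>*"
    then show "(u, v) \<in> rtrancl_on (pverts B) (parcs B \<union> (parcs B)\<inverse>)"
      by induction (use that in \<open>auto intro: rtrancl_on_into_rtrancl_on dest: in_arcsD1 in_arcsD2\<close>)
  qed (rule rtrancl_on_rtranclI)
  then show ?thesis unfolding connected_conv by (auto simp: s)
qed

lemma weak_class_closed:
  assumes "(u, v) \<in> parcs G"
  shows "u \<in> weak_class G a \<longleftrightarrow> v \<in> weak_class G a"
  unfolding weak_class_def using assms
  by (auto intro: rtrancl_into_rtrancl)

lemma weak_class_self [simp]: "a \<in> weak_class G a"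
  by (simp add: weak_class_def)

lemma weak_class_eq:
  assumes "b \<in> weak_class G a"
  shows "weak_class G b = weak_class G a"
proof -
  let ?r = "(parcs G \<union> (parcs G)\<inverse>)\<^sup>*"
  have "sym ?r" by (intro sym_rtrancl) (auto simp: sym_def)
  then show ?thesis using assms unfolding weak_class_def
    by (auto dest: symD intro: rtrancl_trans)
qed

lemma weak_class_subset_verts:
  assumes "pair_wf_digraph G" "a \<in> pverts G"
  shows "weak_class G a \<subseteq> pverts G"
proof
  interpret pair_wf_digraph G by fact
  fix b assume "b \<in> weak_class G a"
  then have "(a, b) \<in> (parcs G \<union> (parcs G)\<inverse>)\<^sup>*" by (simp add: weak_class_def)
  then show "b \<in> pverts G"
    by induction (use assms(2) in \<open>auto dest: in_arcsD1 in_arcsD2\<close>)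
qed

text \<open>
  A connected subgraph lies in the reachability class of any of its vertices, and the subgraph
  induced on a class is itself connected; so the maximal connected subgraphs are exactly these
  induced subgraphs. In particular a component contains every edge that touches it.
\<close>

lemma digraph_component_iff:
  assumes "pair_wf_digraph G"
  shows "digraph_component G B \<longleftrightarrow> (\<exists>a\<in>pverts G. B = induced_on G (weak_class G a))"
proof -
  interpret G: pair_wf_digraph G by fact
  have wfW: "pair_wf_digraph (induced_on G W)" for W
    by unfold_locales (auto simp: induced_on_def)
  have subW: "subgraph (with_proj (induced_on G W)) (with_proj G)" if "W \<subseteq> pverts G" for W
  proof -
    interpret W: pair_wf_digraph "induced_on G W" by (rule wfW)
    show ?thesis unfolding subgraph_def
      using that G.wf_digraph_axioms W.wf_digraph_axioms
      by (auto simp: induced_on_def compatible_def)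
  qed
  have conW: "Digraph_Component.connected (with_proj (induced_on G (weak_class G a)))" for a
  proof -
    let ?W = "weak_class G a" and ?B = "induced_on G (weak_class G a)"
    let ?r = "(parcs ?B \<union> (parcs ?B)\<inverse>)\<^sup>*"
    have "(a, b) \<in> ?r" if "b \<in> ?W" for b
    proof -
      from that have "(a, b) \<in> (parcs G \<union> (parcs G)\<inverse>)\<^sup>*" by (simp add: weak_class_def)
      then show ?thesis
      proof induction
        case (step y z)
        from step.hyps(1) have y: "y \<in> ?W" by (simp add: weak_class_def)
        have z: "z \<in> ?W" using step.hyps y weak_class_closed by (metis Un_iff converseD)
        have "(y, z) \<in> parcs ?B \<union> (parcs ?B)\<inverse>"
          using step.hyps(2) y z by (auto simp: induced_on_def)
        with step.IH show ?case by (rule rtrancl_into_rtrancl)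
      qed simp
    qed
    moreover have "sym ?r" by (intro sym_rtrancl) (auto simp: sym_def)
    ultimately have "(u, v) \<in> ?r" if "u \<in> ?W" "v \<in> ?W" for u v
      using that by (meson rtrancl_trans symD)
    moreover have "pverts ?B = ?W" by (simp add: induced_on_def)
    moreover have "?W \<noteq> {}" using weak_class_self by fast
    ultimately show ?thesis unfolding connected_with_proj_iff[OF wfW] by metis
  qed
  have max: "H = with_proj (induced_on G (weak_class G a))"
    if H: "subgraph H (with_proj G)" "Digraph_Component.connected H" "a \<in> verts H"
      and le: "subgraph (with_proj (induced_on G (weak_class G a))) H" for H a
  proof -
    obtain B where B: "H = with_proj B"
    proof
      show "H = with_proj \<lparr>pverts = verts H, parcs = arcs H\<rparr>"
        using H(1) by (simp add: with_proj_def subgraph_def compatible_def)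
    qed
    have wf: "pair_wf_digraph B"
      using H(1) B unfolding subgraph_def by (auto simp: wf_digraph_def pair_wf_digraph_def)
    have BG: "parcs B \<subseteq> parcs G" "pverts B \<subseteq> pverts G"
      using H(1) B by (auto simp: subgraph_def)
    have mono: "(parcs B \<union> (parcs B)\<inverse>)\<^sup>* \<subseteq> (parcs G \<union> (parcs G)\<inverse>)\<^sup>*"
      using BG(1) by (intro rtrancl_mono) auto
    have "v \<in> weak_class G a" if "v \<in> pverts B" for v
      using H(2,3) mono that unfolding B connected_with_proj_iff[OF wf] weak_class_def by auto
    then have sub: "pverts B \<subseteq> weak_class G a" by blast
    then have "parcs B \<subseteq> parcs G \<inter> weak_class G a \<times> weak_class G a"
      using BG(1) wf unfolding pair_wf_digraph_def by (force)
    moreover have "weak_class G a \<subseteq> pverts B"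
      "parcs G \<inter> weak_class G a \<times> weak_class G a \<subseteq> parcs B"
      using le by (auto simp: B subgraph_def induced_on_def)
    ultimately have "B = induced_on G (weak_class G a)"
      using sub by (intro pair_pre_digraph.equality) (auto simp: induced_on_def)
    then show ?thesis by (simp add: B)
  qed
  show ?thesis
  proof
    assume "digraph_component G B"
    then have c: "subgraph (with_proj B) (with_proj G)" "Digraph_Component.connected (with_proj B)"
      "\<And>H'. H' \<noteq> with_proj B \<Longrightarrow> subgraph (with_proj B) H' \<Longrightarrow> subgraph H' (with_proj G) \<Longrightarrow>
         \<not> Digraph_Component.connected H'"
      by (auto simp: digraph_component_def G.max_subgraph_def)
    have wf: "pair_wf_digraph B"
      using c(1) unfolding subgraph_def by (auto simp: wf_digraph_def pair_wf_digraph_def)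
    obtain a where a: "a \<in> pverts B" using c(2) unfolding connected_with_proj_iff[OF wf] by blast
    have BG: "parcs B \<subseteq> parcs G" "pverts B \<subseteq> pverts G" using c(1) by (auto simp: subgraph_def)
    have mono: "(parcs B \<union> (parcs B)\<inverse>)\<^sup>* \<subseteq> (parcs G \<union> (parcs G)\<inverse>)\<^sup>*"
      using BG(1) by (intro rtrancl_mono) auto
    let ?W = "weak_class G a"
    have aG: "a \<in> pverts G" using a BG by blast
    have BW: "pverts B \<subseteq> ?W"
      using c(2) mono a unfolding connected_with_proj_iff[OF wf] weak_class_def by auto
    have sW: "subgraph (with_proj (induced_on G ?W)) (with_proj G)"
      using subW weak_class_subset_verts[OF assms aG] by blast
    have "subgraph (with_proj B) (with_proj (induced_on G ?W))"
      using BW BG wf c(1) sW unfolding subgraph_def pair_wf_digraph_def induced_on_def compatible_def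
      by force
    then have "with_proj (induced_on G ?W) = with_proj B"
      using c(3) sW conW by blast
    then have "induced_on G ?W = B"
      by (metis (full_types) old.unit.exhaust pair_pre_digraph.surjective with_proj_simps(1,2))
    then show "\<exists>a\<in>pverts G. B = induced_on G (weak_class G a)" using aG by blast
  next
    assume "\<exists>a\<in>pverts G. B = induced_on G (weak_class G a)"
    then obtain a where a: "a \<in> pverts G" "B = induced_on G (weak_class G a)" by blast
    show "digraph_component G B"
      unfolding digraph_component_def G.max_subgraph_def
    proof (intro conjI allI impI notI)
      show "subgraph (with_proj B) (with_proj G)" "Digraph_Component.connected (with_proj B)"
        using subW weak_class_subset_verts[OF assms a(1)] conW a(2) by auto
      fix H assume H: "H \<noteq> with_proj B \<and> subgraph (with_proj B) H"
        "subgraph H (with_proj G) \<and> Digraph_Component.connected H"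
      have "a \<in> verts H" using H(1) a(2) weak_class_self[of a G]
        by (auto simp: subgraph_def induced_on_def)
      then show False using max[of H a] H a(2) by blast
    qed
  qed
qed

section \<open>Balloons with consecutively numbered vertices\<close>

text \<open>
  The vertices \<open>v\<^sub>1, \<dots>, v\<^sub>s, w\<^sub>1, \<dots>, w\<^sub>t\<close> of a balloon are numbered \<open>0, \<dots>, s + t - 1\<close>. Every vertex has
  exactly one outgoing edge, and the two edges into \<open>w\<^sub>1\<close>, which has number \<open>s\<close>, are the
  step from \<open>s - 1\<close> to \<open>s\<close> and the return from \<open>s + t - 1\<close>.
\<close>

definition next_pos :: "nat \<Rightarrow> nat \<Rightarrow> nat \<Rightarrow> nat" where
  "next_pos s t k = (if Suc k < s + t then Suc k else s)"

definition balloon_enum :: "nat \<Rightarrow> nat \<Rightarrow> (nat \<Rightarrow> 'a) \<Rightarrow> 'a pair_pre_digraph \<Rightarrow> bool" where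
  "balloon_enum s t u B \<longleftrightarrow> inj_on u {..<s + t} \<and> pverts B = u ` {..<s + t} \<and>
     parcs B = {(u k, u (next_pos s t k)) | k. k < s + t}"

lemma next_pos_less: "1 \<le> t \<Longrightarrow> next_pos s t k < s + t"
  by (auto simp: next_pos_def)

lemma labelling_imp_enum:
  assumes "balloon_labelling s t v w B"
  shows "balloon_enum s t (\<lambda>k. if k < s then v (Suc k) else w (Suc (k - s))) B"
    (is "balloon_enum s t ?u B")
proof -
  have st: "1 \<le> s" "1 \<le> t" and inj: "inj_on v {1..s}" "inj_on w {1..t}"
    and dis: "v ` {1..s} \<inter> w ` {1..t} = {}"
    and verts: "pverts B = v ` {1..s} \<union> w ` {1..t}"
    and arcs: "parcs B = {(v i, v (i + 1)) | i. 1 \<le> i \<and> i < s} \<union>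
        {(w j, w (j + 1)) | j. 1 \<le> j \<and> j < t} \<union> {(w t, w 1), (v s, w 1)}"
    using assms by (auto simp: balloon_labelling_def)
  have v: "v ` {1..s} = ?u ` {..<s}"
  proof (intro equalityI subsetI; elim imageE)
    fix x i assume "x = v i" "i \<in> {1..s}"
    then show "x \<in> ?u ` {..<s}"
      by (intro image_eqI[of _ _ "i - 1"]) auto
  next
    fix x k assume "x = ?u k" "k \<in> {..<s}"
    then show "x \<in> v ` {1..s}"
      by (intro image_eqI[of _ _ "Suc k"]) auto
  qed
  have w: "w ` {1..t} = ?u ` {s..<s + t}"
  proof (intro equalityI subsetI; elim imageE)
    fix x j assume "x = w j" "j \<in> {1..t}"
    then show "x \<in> ?u ` {s..<s + t}"
      by (intro image_eqI[of _ _ "s + j - 1"]) auto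
  next
    fix x k assume "x = ?u k" "k \<in> {s..<s + t}"
    then show "x \<in> w ` {1..t}"
      by (intro image_eqI[of _ _ "Suc (k - s)"]) auto
  qed
  have split: "{..<s + t} = {..<s} \<union> {s..<s + t}" by auto
  have "inj_on ?u ({..<s} \<union> {s..<s + t})"
  proof (rule inj_on_Un[THEN iffD2], intro conjI)
    show "inj_on ?u {..<s}"
    proof (rule inj_onI)
      fix x y assume xy: "x \<in> {..<s}" "y \<in> {..<s}" "?u x = ?u y"
      then have "Suc x = Suc y" by (intro inj_onD[OF inj(1)]) auto
      then show "x = y" by simp
    qed
    show "inj_on ?u {s..<s + t}"
    proof (rule inj_onI)
      fix x y assume xy: "x \<in> {s..<s + t}" "y \<in> {s..<s + t}" "?u x = ?u y"
      then have "Suc (x - s) = Suc (y - s)" by (intro inj_onD[OF inj(2)]) auto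
      then show "x = y" using xy by auto
    qed
    have "?u ` {..<s} \<inter> ?u ` {s..<s + t} = {}" using dis unfolding v w .
    then show "?u ` ({..<s} - {s..<s + t}) \<inter> ?u ` ({s..<s + t} - {..<s}) = {}"
      by (auto 4 3)
  qed
  moreover have "pverts B = ?u ` {..<s + t}"
    unfolding verts v w split image_Un ..
  moreover have "parcs B = {(?u k, ?u (next_pos s t k)) | k. k < s + t}"
  proof (intro equalityI subsetI)
    fix e assume "e \<in> parcs B"
    then consider i where "e = (v i, v (i + 1))" "1 \<le> i" "i < s"
      | j where "e = (w j, w (j + 1))" "1 \<le> j" "j < t" | "e = (w t, w 1)" | "e = (v s, w 1)"
      unfolding arcs by blast
    then have "\<exists>k<s + t. e = (?u k, ?u (next_pos s t k))"
    proof cases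
      case 1 then show ?thesis by (intro exI[of _ "i - 1"]) (auto simp: next_pos_def)
    next
      case 2 then show ?thesis
        by (intro exI[of _ "s + j - 1"]) (auto simp: next_pos_def Suc_diff_le)
    next
      case 3 then show ?thesis using st
        by (intro exI[of _ "s + t - 1"]) (auto simp: next_pos_def)
    next
      case 4 then show ?thesis using st
        by (intro exI[of _ "s - 1"]) (auto simp: next_pos_def)
    qed
    then show "e \<in> {(?u k, ?u (next_pos s t k)) | k. k < s + t}" by blast
  next
    fix e assume "e \<in> {(?u k, ?u (next_pos s t k)) | k. k < s + t}"
    then obtain k where k: "k < s + t" "e = (?u k, ?u (next_pos s t k))" by blast
    consider "Suc k < s" | "Suc k = s" | "s \<le> k" "Suc k < s + t" | "s \<le> k" "Suc k = s + t"
      using k(1) by linarith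
    then show "e \<in> parcs B"
    proof cases
      case 1 then have "e = (v (Suc k), v (Suc k + 1)) \<and> 1 \<le> Suc k \<and> Suc k < s"
        using k by (auto simp: next_pos_def)
      then show ?thesis unfolding arcs by blast
    next
      case 2 then have "e = (v s, w 1)" using k st by (auto simp: next_pos_def)
      then show ?thesis unfolding arcs by blast
    next
      case 3 then have "e = (w (Suc (k - s)), w (Suc (k - s) + 1)) \<and> 1 \<le> Suc (k - s) \<and> Suc (k - s) < t"
        using k by (auto simp: next_pos_def Suc_diff_le)
      then show ?thesis unfolding arcs by blast
    next
      case 4 then have "Suc (k - s) = t" by linarith
      then have "e = (w t, w 1)" using k 4 by (auto simp: next_pos_def)
      then show ?thesis unfolding arcs by blast
    qed
  qed
  ultimately show ?thesis by (simp add: balloon_enum_def flip: split)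
qed

lemma enum_imp_labelling:
  assumes "balloon_enum s t u B" "1 \<le> s" "1 \<le> t"
  shows "balloon_labelling s t (\<lambda>i. u (i - 1)) (\<lambda>j. u (s + j - 1)) B"
proof -
  have inj: "inj_on u {..<s + t}" and verts: "pverts B = u ` {..<s + t}"
    and arcs: "parcs B = {(u k, u (next_pos s t k)) | k. k < s + t}"
    using assms(1) by (auto simp: balloon_enum_def)
  have I: "u x = u y \<longleftrightarrow> x = y" if "x < s + t" "y < s + t" for x y
    using inj_on_eq_iff[OF inj] that by auto
  have "inj_on (\<lambda>i. u (i - 1)) {1..s}" by (auto intro!: inj_onI simp: I)
  moreover have "inj_on (\<lambda>j. u (s + j - 1)) {1..t}" by (auto intro!: inj_onI simp: I)
  moreover have "(\<lambda>i. u (i - 1)) ` {1..s} \<inter> (\<lambda>j. u (s + j - 1)) ` {1..t} = {}"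
    by (auto simp: I)
  moreover have "u ` {..<s + t} = (\<lambda>i. u (i - 1)) ` {1..s} \<union> (\<lambda>j. u (s + j - 1)) ` {1..t}"
  proof (intro equalityI subsetI; elim imageE UnE)
    fix x k assume k: "x = u k" "k \<in> {..<s + t}"
    show "x \<in> (\<lambda>i. u (i - 1)) ` {1..s} \<union> (\<lambda>j. u (s + j - 1)) ` {1..t}"
    proof (cases "k < s")
      case True then show ?thesis using k by (intro UnI1 image_eqI[of _ _ "Suc k"]) auto
    next
      case False then show ?thesis using k by (intro UnI2 image_eqI[of _ _ "Suc (k - s)"]) auto
    qed
  qed auto
  moreover have "parcs B = {(u (i - 1), u (i + 1 - 1)) | i. 1 \<le> i \<and> i < s} \<union>
      {(u (s + j - 1), u (s + (j + 1) - 1)) | j. 1 \<le> j \<and> j < t} \<union>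
      {(u (s + t - 1), u (s + 1 - 1)), (u (s - 1), u (s + 1 - 1))}" (is "_ = ?R")
  proof (intro equalityI subsetI)
    fix e assume "e \<in> parcs B"
    then obtain k where k: "k < s + t" "e = (u k, u (next_pos s t k))" unfolding arcs by blast
    consider "Suc k < s" | "Suc k = s" | "s \<le> k" "Suc k < s + t" | "s \<le> k" "Suc k = s + t"
      using k(1) by linarith
    then show "e \<in> ?R"
    proof cases
      case 1 then have "e = (u (Suc k - 1), u (Suc k + 1 - 1)) \<and> 1 \<le> Suc k \<and> Suc k < s"
        using k by (auto simp: next_pos_def)
      then show ?thesis by blast
    next
      case 2 then have "e = (u (s - 1), u (s + 1 - 1))" using k assms by (auto simp: next_pos_def)
      then show ?thesis by blast
    next
      case 3 then have "e = (u (s + Suc (k - s) - 1), u (s + (Suc (k - s) + 1) - 1)) \<and>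
          1 \<le> Suc (k - s) \<and> Suc (k - s) < t"
        using k by (auto simp: next_pos_def)
      then show ?thesis by blast
    next
      case 4 then have "k = s + t - 1" by simp
      then have "e = (u (s + t - 1), u (s + 1 - 1))" using k 4 by (auto simp: next_pos_def)
      then show ?thesis by blast
    qed
  next
    fix e assume "e \<in> ?R"
    then consider i where "e = (u (i - 1), u (i + 1 - 1))" "1 \<le> i" "i < s"
      | j where "e = (u (s + j - 1), u (s + (j + 1) - 1))" "1 \<le> j" "j < t"
      | "e = (u (s + t - 1), u (s + 1 - 1))" | "e = (u (s - 1), u (s + 1 - 1))"
      by blast
    then have "\<exists>k<s + t. e = (u k, u (next_pos s t k))"
    proof cases
      case 1 then show ?thesis by (intro exI[of _ "i - 1"]) (auto simp: next_pos_def)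
    next
      case 2 then show ?thesis by (intro exI[of _ "s + j - 1"]) (auto simp: next_pos_def)
    next
      case 3 then show ?thesis using assms
        by (intro exI[of _ "s + t - 1"]) (auto simp: next_pos_def)
    next
      case 4 then show ?thesis using assms
        by (intro exI[of _ "s - 1"]) (auto simp: next_pos_def)
    qed
    then show "e \<in> parcs B" unfolding arcs by blast
  qed
  ultimately show ?thesis
    unfolding balloon_labelling_def using assms(2,3) verts by simp
qed

text \<open>
  Strictness says that each vertex is larger than the union of the images of its predecessors.
  Because no other points are mapped into that vertex, which is what the assumption on edges
  expresses, the extra point is outside the range of \<open>f\<close>. The first vertex of the path has no
  predecessor at all.
\<close>

lemma strict_balloon_point_outside_range:
  assumes strict: "strict_balloon f B" and a: "a \<in> pverts B" "a \<noteq> {}"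
    and pre: "\<And>y. f y \<in> a \<Longrightarrow> \<exists>b. y \<in> b \<and> (b, a) \<in> parcs B"
  shows "\<exists>x\<in>a. x \<notin> range f"
proof -
  obtain s t v w where *: "balloon_labelling s t v w B \<and>
      (\<forall>i. 1 \<le> i \<and> i < s \<longrightarrow> f ` v i \<subset> v (i + 1)) \<and>
      (\<forall>j. 1 \<le> j \<and> j < t \<longrightarrow> f ` w j \<subset> w (j + 1)) \<and> f ` v s \<union> f ` w t \<subset> w 1"
    using strict unfolding strict_balloon_def by (elim exE)
  then have lab: "balloon_labelling s t v w B"
    and sv: "\<And>i. 1 \<le> i \<Longrightarrow> i < s \<Longrightarrow> f ` v i \<subset> v (i + 1)"
    and sw: "\<And>j. 1 \<le> j \<Longrightarrow> j < t \<Longrightarrow> f ` w j \<subset> w (j + 1)"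
    and s1: "f ` v s \<union> f ` w t \<subset> w 1"
    by simp_all
  have st: "1 \<le> s" "1 \<le> t" using lab by (auto simp: balloon_labelling_def)
  define u where "u k = (if k < s then v (Suc k) else w (Suc (k - s)))" for k
  have inju: "inj_on u {..<s + t}" and verts: "pverts B = u ` {..<s + t}"
    and arcs: "parcs B = {(u k, u (next_pos s t k)) | k. k < s + t}"
    using labelling_imp_enum[OF lab] unfolding balloon_enum_def u_def by blast+
  obtain n where n: "n < s + t" "a = u n" using a(1) unfolding verts by blast
  have "\<exists>x\<in>u n. \<forall>k<s + t. next_pos s t k = n \<longrightarrow> x \<notin> f ` u k"
  proof -
    consider "n = 0" | "0 < n" "n < s" | "n = s" | "s < n" by linarith
    then show ?thesis
    proof cases
      case 1
      then have "next_pos s t k \<noteq> n" for k using st by (simp add: next_pos_def)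
      then show ?thesis using a(2) n(2) by blast
    next
      case 2
      have "f ` v n \<subset> v (n + 1)" using 2 by (intro sv) auto
      then obtain x where x: "x \<in> v (n + 1)" "x \<notin> f ` v n" by blast
      have "u k = v n" if "next_pos s t k = n" for k
        using that 2 by (auto simp: next_pos_def u_def split: if_splits)
      moreover have "u n = v (n + 1)" using 2 by (simp add: u_def)
      ultimately show ?thesis using x by metis
    next
      case 3
      obtain x where x: "x \<in> w 1" "x \<notin> f ` v s" "x \<notin> f ` w t" using s1 by blast
      have "u k = v s \<or> u k = w t" if "next_pos s t k = n" "k < s + t" for k
      proof (cases "Suc k = s")
        case True then show ?thesis by (auto simp: u_def)
      next
        case False
        then have "Suc k = s + t" using that 3 st by (auto simp: next_pos_def split: if_splits)
        then have "\<not> k < s" "Suc (k - s) = t" using st by auto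
        then show ?thesis by (simp add: u_def)
      qed
      moreover have "u n = w 1" using 3 by (simp add: u_def)
      ultimately show ?thesis using x by metis
    next
      case 4
      have "f ` w (n - s) \<subset> w (n - s + 1)" using 4 n(1) by (intro sw) auto
      then obtain x where x: "x \<in> w (n - s + 1)" "x \<notin> f ` w (n - s)" by blast
      have "u k = w (n - s)" if "next_pos s t k = n" for k
        using that 4 by (auto simp: next_pos_def u_def Suc_diff_le split: if_splits)
      moreover have "u n = w (n - s + 1)" using 4 by (simp add: u_def)
      ultimately show ?thesis using x by metis
    qed
  qed
  then obtain x where x: "x \<in> u n" "\<And>k. k < s + t \<Longrightarrow> next_pos s t k = n \<Longrightarrow> x \<notin> f ` u k"
    by blast
  have "x \<notin> range f"
  proof
    assume "x \<in> range f"
    then obtain y where y: "x = f y" by blast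
    then obtain b where b: "y \<in> b" "(b, u n) \<in> parcs B" using pre a(1) x(1) n(2) by metis
    then obtain k where k: "k < s + t" "b = u k" "u n = u (next_pos s t k)" unfolding arcs by blast
    then have "next_pos s t k = n"
      using inj_onD[OF inju, of n "next_pos s t k"] n(1) next_pos_less st by auto
    then show False using x(2)[OF k(1)] b(1) k(2) y by blast
  qed
  then show ?thesis using x(1) n(2) by blast
qed

section \<open>Balloon codings\<close>

definition balloon_step :: "nat \<Rightarrow> nat \<Rightarrow> 'a \<times> nat \<Rightarrow> 'a \<times> nat" where
  "balloon_step s t d = (fst d, next_pos s t (snd d))"

text \<open>
  A system of strict balloons of type \<open>(s, t)\<close>, one for each name in \<open>C\<close>, whose vertices are the
  fibres of \<open>p\<close>. Names are arbitrary objects, and \<open>s = 0\<close> is possible: a single name with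
  \<open>s = 0\<close> and \<open>t = 1\<close> is the trivial coding from which the back-and-forth construction starts.
\<close>

definition balloon_coding ::
    "(cantor \<Rightarrow> cantor) \<Rightarrow> 'a set \<Rightarrow> nat \<Rightarrow> nat \<Rightarrow> (cantor \<Rightarrow> 'a \<times> nat) \<Rightarrow> bool" where
  "balloon_coding f C s t p \<longleftrightarrow> finite C \<and> 1 \<le> t \<and> locally_constant p \<and>
     range p \<subseteq> C \<times> {..<s + t} \<and> (\<forall>x. p (f x) = balloon_step s t (p x)) \<and>
     (\<forall>d\<in>C \<times> {..<s + t}. \<exists>x. x \<notin> range f \<and> p x = d)"

lemma
  assumes "balloon_coding f C s t p"
  shows coding_finite: "finite C" and coding_cycle: "1 \<le> t"
    and coding_locally_constant: "locally_constant p"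
    and coding_in: "p x \<in> C \<times> {..<s + t}"
    and coding_step: "p (f x) = balloon_step s t (p x)"
    and coding_outside: "d \<in> C \<times> {..<s + t} \<Longrightarrow> \<exists>x. x \<notin> range f \<and> p x = d"
    and coding_onto: "d \<in> C \<times> {..<s + t} \<Longrightarrow> \<exists>x. p x = d"
proof -
  have *: "finite C" "1 \<le> t" "locally_constant p" "range p \<subseteq> C \<times> {..<s + t}"
    "\<forall>x. p (f x) = balloon_step s t (p x)" "\<forall>d\<in>C \<times> {..<s + t}. \<exists>x. x \<notin> range f \<and> p x = d"
    using assms unfolding balloon_coding_def by simp_all
  show "finite C" "1 \<le> t" "locally_constant p" "p (f x) = balloon_step s t (p x)"
    using * by simp_all
  show "p x \<in> C \<times> {..<s + t}" using *(4) by (rule range_subsetD)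
  show "\<exists>x. x \<notin> range f \<and> p x = d" if "d \<in> C \<times> {..<s + t}"
    using *(6) that by (rule bspec)
  then show "\<exists>x. p x = d" if "d \<in> C \<times> {..<s + t}" using that by blast
qed

lemma balloon_step_in: "1 \<le> t \<Longrightarrow> d \<in> C \<times> {..<s + t} \<Longrightarrow> balloon_step s t d \<in> C \<times> {..<s + t}"
  by (auto simp: balloon_step_def next_pos_less)

lemma wf_Gr: "pair_wf_digraph (Gr f P)"
  by unfold_locales (auto simp: Gr_def)

lemma Gr_arc_iff: "(a, b) \<in> parcs (Gr f P) \<longleftrightarrow> a \<in> P \<and> b \<in> P \<and> f ` a \<inter> b \<noteq> {}"
  by (simp add: Gr_def)

lemma fibres_clopen_partition:
  assumes "balloon_coding f C s t p"
  shows "clopen_partition ((\<lambda>d. p -` {d}) ` (C \<times> {..<s + t}))"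
proof -
  have lc: "locally_constant p" and fin: "finite C" and rng: "p x \<in> C \<times> {..<s + t}" for x
    using assms by (auto simp: balloon_coding_def)
  have "p -` {d} \<noteq> {}" if "d \<in> C \<times> {..<s + t}" for d
    using assms that unfolding balloon_coding_def by blast
  moreover have "disjoint ((\<lambda>d. p -` {d}) ` (C \<times> {..<s + t}))"
    by (auto simp: disjoint_def)
  moreover have "(\<Union>d\<in>C \<times> {..<s + t}. p -` {d}) = UNIV" using rng by auto
  ultimately show ?thesis unfolding clopen_partition_def
    using fin lc by (simp add: open_fibre closed_fibre image_iff) (metis SigmaI lessThan_iff)
qed

text \<open>
  Since \<open>p \<circ> f\<close> is \<open>step \<circ> p\<close>, edges join only fibres with the same name, and all fibres with one name
  are joined along the positions. So the components are the names.
\<close>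

lemma fibres_components:
  assumes cod: "balloon_coding f C s t p" and s: "1 \<le> s"
    and comp: "digraph_component (Gr f ((\<lambda>d. p -` {d}) ` (C \<times> {..<s + t}))) B"
  shows "balloon s t B \<and> strict_balloon f B"
proof -
  define D where "D = C \<times> {..<s + t}"
  define F where "F d = p -` {d}" for d
  define G where "G = Gr f (F ` D)"
  have t: "1 \<le> t" and rng: "\<And>x. p x \<in> D" and step: "\<And>x. p (f x) = balloon_step s t (p x)"
    and out: "\<And>d. d \<in> D \<Longrightarrow> \<exists>x. x \<notin> range f \<and> p x = d"
    using cod by (auto simp: balloon_coding_def D_def)
  have ne: "F d \<noteq> {}" if "d \<in> D" for d using out[OF that] by (auto simp: F_def)
  have inj: "F d = F e \<longleftrightarrow> d = e" if "d \<in> D" for d e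
    using ne[OF that] unfolding F_def by (metis ex_in_conv vimage_singleton_eq)
  have img: "f ` F d \<subseteq> F (balloon_step s t d)" for d by (auto simp: F_def step)
  have arcs: "parcs G = {(F d, F (balloon_step s t d)) | d. d \<in> D}"
  proof -
    have meet: "f ` F d \<inter> F e \<noteq> {} \<longleftrightarrow> e = balloon_step s t d" if "d \<in> D" for d e
      using img[of d] ne[OF that] by (auto simp: F_def step)
    have stepD: "balloon_step s t d \<in> D" if "d \<in> D" for d
      using balloon_step_in[OF t] that unfolding D_def by blast
    show ?thesis
    proof (intro equalityI subsetI)
      fix x assume "x \<in> parcs G"
      moreover obtain a b where ab: "x = (a, b)" by (cases x)
      ultimately have "a \<in> F ` D \<and> b \<in> F ` D \<and> f ` a \<inter> b \<noteq> {}"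
        unfolding G_def by (simp only: Gr_arc_iff simp_thms)
      then obtain d e where de: "a = F d" "b = F e" "d \<in> D" "f ` F d \<inter> F e \<noteq> {}" by blast
      then have "e = balloon_step s t d" using meet by blast
      then show "x \<in> {(F d, F (balloon_step s t d)) | d. d \<in> D}" using ab de by blast
    next
      fix x assume "x \<in> {(F d, F (balloon_step s t d)) | d. d \<in> D}"
      then obtain d where "d \<in> D" "x = (F d, F (balloon_step s t d))" by blast
      then show "x \<in> parcs G" unfolding G_def Gr_def using meet[of d] stepD[of d] by simp
    qed
  qed
  obtain c k where ck: "(c, k) \<in> D" "B = induced_on G (weak_class G (F (c, k)))"
  proof -
    have "digraph_component G B" using comp by (simp add: G_def F_def D_def)
    then obtain a where "a \<in> pverts G" "B = induced_on G (weak_class G a)"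
      unfolding G_def digraph_component_iff[OF wf_Gr] by blast
    then show ?thesis using that by (auto simp: G_def Gr_def)
  qed
  have c: "c \<in> C" using ck(1) by (simp add: D_def)
  define u where "u j = F (c, j)" for j
  have cD: "(c, j) \<in> D \<longleftrightarrow> j < s + t" for j using c by (simp add: D_def)
  have in0: "u j \<in> weak_class G (u 0)" if "j < s + t" for j
    using that
  proof (induction j)
    case (Suc j)
    then have "(u j, u (Suc j)) \<in> parcs G"
      unfolding arcs u_def using cD[of j] by (force simp: balloon_step_def next_pos_def)
    then show ?case using Suc weak_class_closed by (metis Suc_lessD)
  qed simp
  have "weak_class G (F (c, k)) = weak_class G (u 0)"
    using weak_class_eq[OF in0[of k]] ck(1) cD by (simp add: u_def)
  also have "\<dots> = u ` {..<s + t}"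
  proof
    show "weak_class G (u 0) \<subseteq> u ` {..<s + t}"
    proof
      fix a assume "a \<in> weak_class G (u 0)"
      then have "(u 0, a) \<in> (parcs G \<union> (parcs G)\<inverse>)\<^sup>*" by (simp add: weak_class_def)
      then show "a \<in> u ` {..<s + t}"
      proof induction
        case (step a b)
        then obtain j where j: "j < s + t" "a = F (c, j)" by (auto simp: u_def)
        from step.hyps(2) obtain e where e: "e \<in> D"
          "(a = F e \<and> b = F (balloon_step s t e)) \<or> (b = F e \<and> a = F (balloon_step s t e))"
          unfolding arcs by blast
        have "e \<in> D \<and> fst e = c"
          using e inj[of "(c, j)", OF cD[THEN iffD2, OF j(1)]] unfolding j(2)
          by (auto simp: balloon_step_def)
        then obtain i where i: "e = (c, i)" "i < s + t" using cD by (cases e) auto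
        have "\<exists>i<s + t. b = F (c, i)"
          using e(2) i next_pos_less[OF t] by (auto simp: balloon_step_def)
        then show ?case by (auto simp: u_def)
      qed (use t in auto)
    qed
  qed (use in0 in blast)
  finally have B: "B = induced_on G (u ` {..<s + t})" using ck(2) by simp
  have en: "balloon_enum s t u B"
    unfolding balloon_enum_def
  proof (intro conjI)
    show "inj_on u {..<s + t}" using inj cD by (auto simp: inj_on_def u_def)
    show "pverts B = u ` {..<s + t}" by (simp add: B induced_on_def)
    show "parcs B = {(u k, u (next_pos s t k)) | k. k < s + t}"
    proof (intro equalityI subsetI)
      fix e assume "e \<in> parcs B"
      then have e: "e \<in> parcs G" "fst e \<in> u ` {..<s + t}" by (auto simp: B induced_on_def)
      from e(1) obtain d where d: "d \<in> D" "e = (F d, F (balloon_step s t d))" unfolding arcs by blast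
      with e(2) inj[OF d(1)] obtain j where "j < s + t" "d = (c, j)" by (auto simp: u_def)
      then show "e \<in> {(u k, u (next_pos s t k)) | k. k < s + t}"
        using d(2) by (auto simp: u_def balloon_step_def)
    next
      fix e assume "e \<in> {(u k, u (next_pos s t k)) | k. k < s + t}"
      then obtain j where j: "j < s + t" "e = (u j, u (next_pos s t j))" by blast
      then have "e = (F (c, j), F (balloon_step s t (c, j)))" by (simp add: u_def balloon_step_def)
      then have "e \<in> parcs G" unfolding arcs using cD j(1) by blast
      then show "e \<in> parcs B" using j next_pos_less[OF t] by (auto simp: B induced_on_def)
    qed
  qed
  have lab: "balloon_labelling s t (\<lambda>i. u (i - 1)) (\<lambda>j. u (s + j - 1)) B"
    by (rule enum_imp_labelling[OF en s t])
  have iu: "f ` u j \<subseteq> u (next_pos s t j)" for j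
    using img[of "(c, j)"] by (simp add: u_def balloon_step_def)
  have ou: "\<exists>x\<in>u j. x \<notin> range f" if "j < s + t" for j
    using out[of "(c, j)"] that cD by (auto simp: u_def F_def)
  have proper: "A \<subset> u j" if "A \<subseteq> u j" "A \<subseteq> range f" "j < s + t" for A j
    using ou[OF that(3)] that by blast
  have "strict_balloon f B" unfolding strict_balloon_def
  proof (intro exI conjI allI impI)
    show "balloon_labelling s t (\<lambda>i. u (i - 1)) (\<lambda>j. u (s + j - 1)) B" by (rule lab)
    show "f ` u (i - 1) \<subset> u (i + 1 - 1)" if "1 \<le> i \<and> i < s" for i
      using iu[of "i - 1"] that by (intro proper) (auto simp: next_pos_def)
    show "f ` u (s + j - 1) \<subset> u (s + (j + 1) - 1)" if "1 \<le> j \<and> j < t" for j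
      using iu[of "s + j - 1"] that by (intro proper) (auto simp: next_pos_def)
    show "f ` u (s - 1) \<union> f ` u (s + t - 1) \<subset> u (s + 1 - 1)"
      using iu[of "s - 1"] iu[of "s + t - 1"] s t by (intro proper) (auto simp: next_pos_def)
  qed
  then show ?thesis using lab unfolding balloon_def by blast
qed

text \<open>
  The components themselves serve as names. A point is coded by the component of the partition
  member that contains it and the number of this member in that balloon.
\<close>

lemma partition_imp_coding:
  assumes P: "clopen_partition P" and t: "1 \<le> t"
    and comp: "\<And>B. digraph_component (Gr f P) B \<Longrightarrow> balloon s t B \<and> strict_balloon f B"
  obtains p where "balloon_coding f {B. digraph_component (Gr f P) B} s t p"
    and "\<forall>x y. p x = p y \<longrightarrow> (\<exists>a\<in>P. x \<in> a \<and> y \<in> a)"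
proof -
  define G where "G = Gr f P"
  define C where "C = {B. digraph_component G B}"
  define D where "D = C \<times> {..<s + t}"
  have P': "finite P" "{} \<notin> P" "disjoint P" "\<forall>a\<in>P. open a \<and> closed a" "\<Union>P = UNIV"
    using P by (simp_all add: clopen_partition_def)
  have disj: "a = b" if "a \<in> P" "b \<in> P" "x \<in> a" "x \<in> b" for a b x
    using P'(3) that unfolding disjoint_def by blast
  have cover: "\<exists>a\<in>P. x \<in> a" for x using P'(5) by blast
  have opn: "open a" if "a \<in> P" for a using P'(4) that by blast
  have C_iff: "B \<in> C \<longleftrightarrow> (\<exists>a\<in>P. B = induced_on G (weak_class G a))" for B
    using digraph_component_iff[OF wf_Gr, of f P B] by (simp add: C_def G_def Gr_def)
  have "C = (\<lambda>a. induced_on G (weak_class G a)) ` P" using C_iff by blast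
  then have finC: "finite C" using P'(1) by simp
  have vB: "pverts B \<subseteq> P" if "B \<in> C" for B
  proof -
    from that obtain a where a: "a \<in> P" "B = induced_on G (weak_class G a)" using C_iff by blast
    then show ?thesis using weak_class_subset_verts[OF wf_Gr, of a f P]
      by (simp add: induced_on_def G_def Gr_def)
  qed
  have B_eq: "B = induced_on G (weak_class G a)" if "B \<in> C" "a \<in> pverts B" for B a
  proof -
    from that(1) obtain b where b: "B = induced_on G (weak_class G b)" using C_iff by blast
    then have "a \<in> weak_class G b" using that(2) by (simp add: induced_on_def)
    then show ?thesis using b weak_class_eq by metis
  qed
  have arc_in: "(a, b) \<in> parcs B" if "B \<in> C" "(a, b) \<in> parcs G" "a \<in> pverts B \<or> b \<in> pverts B" for a b B
  proof -
    from that(1) obtain c where c: "B = induced_on G (weak_class G c)" using C_iff by blast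
    then show ?thesis using that(2,3) weak_class_closed[OF that(2)] by (auto simp: induced_on_def)
  qed
  have "\<exists>u. balloon_enum s t u B" if B: "B \<in> C" for B
  proof -
    have "balloon s t B" using comp B by (simp add: C_def G_def)
    then show ?thesis using labelling_imp_enum unfolding balloon_def by blast
  qed
  then obtain U where U: "\<And>B. B \<in> C \<Longrightarrow> balloon_enum s t (U B) B" by metis
  define pos where "pos d = U (fst d) (snd d)" for d
  have pos_vert: "pos d \<in> pverts (fst d)" if "d \<in> D" for d
  proof -
    have "fst d \<in> C" "snd d < s + t" using that by (auto simp: D_def)
    then show ?thesis using U[of "fst d"] by (auto simp: balloon_enum_def pos_def)
  qed
  have posP: "pos d \<in> P" if "d \<in> D" for d
    using vB[of "fst d"] pos_vert[OF that] that by (auto simp: D_def)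
  have ex: "\<exists>d. d \<in> D \<and> x \<in> pos d" for x
  proof -
    obtain a where a: "a \<in> P" "x \<in> a" using cover by blast
    define B where "B = induced_on G (weak_class G a)"
    have B: "B \<in> C" unfolding C_iff B_def using a(1) by blast
    have "a \<in> pverts B" by (simp add: B_def induced_on_def)
    then obtain k where "k < s + t" "a = U B k" using U[OF B] unfolding balloon_enum_def by blast
    then have "(B, k) \<in> D \<and> x \<in> pos (B, k)" using a(2) B by (simp add: D_def pos_def)
    then show ?thesis by blast
  qed
  have uniq: "d = e" if "d \<in> D" "e \<in> D" "x \<in> pos d" "x \<in> pos e" for d e x
  proof -
    have eq: "pos d = pos e" using disj posP that by blast
    have C: "fst d \<in> C" "fst e \<in> C" "snd d < s + t" "snd e < s + t"
      using that(1,2) by (auto simp: D_def)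
    have fst: "fst d = fst e"
      using B_eq[OF C(1) pos_vert[OF that(1)]] B_eq[OF C(2) pos_vert[OF that(2)]] eq by simp
    moreover have "inj_on (U (fst d)) {..<s + t}" using U[OF C(1)] by (simp add: balloon_enum_def)
    then have "snd d = snd e" using eq C(3,4) unfolding pos_def fst by (simp add: inj_on_eq_iff)
    ultimately show ?thesis by (simp add: prod_eq_iff)
  qed
  obtain p where p: "\<And>x. p x \<in> D" "\<And>x. x \<in> pos (p x)" using ex by metis
  have pI: "p x = d" if "d \<in> D" "x \<in> pos d" for x d using uniq that p by blast
  have fibre: "p -` {d} = (if d \<in> D then pos d else {})" for d
  proof -
    have "p x = d \<longleftrightarrow> d \<in> D \<and> x \<in> pos d" for x using pI p by metis
    then show ?thesis unfolding set_eq_iff by simp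
  qed
  have lc: "locally_constant p"
  proof (rule locally_constantI)
    fix d
    show "open (p -` {d})"
      using opn[OF posP[of d]] unfolding fibre
      by (cases "d \<in> D") (simp_all only: if_True if_False open_empty)
  qed
  have step: "p (f x) = balloon_step s t (p x)" for x
  proof (rule pI)
    show D: "balloon_step s t (p x) \<in> D"
      using p(1)[of x] unfolding D_def by (rule balloon_step_in[OF t])
    obtain B k where Bk: "p x = (B, k)" by (cases "p x")
    have B: "B \<in> C" "k < s + t" using p(1)[of x] Bk by (auto simp: D_def)
    have "f x \<in> f ` pos (p x) \<inter> pos (p (f x))"
      using p(2)[of x] p(2)[of "f x"] by (intro IntI imageI)
    then have "f ` pos (p x) \<inter> pos (p (f x)) \<noteq> {}" by (metis empty_iff)
    then have "(pos (p x), pos (p (f x))) \<in> parcs G"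
      unfolding G_def Gr_arc_iff by (intro conjI posP p(1))
    moreover have "pos (p x) \<in> pverts B" using pos_vert[OF p(1)[of x]] by (metis Bk fst_conv)
    ultimately have "(pos (p x), pos (p (f x))) \<in> parcs B"
      by (intro arc_in[OF B(1)] disjI1)
    moreover have "parcs B = {(U B k, U B (next_pos s t k)) | k. k < s + t}"
      using U[OF B(1)] by (simp add: balloon_enum_def)
    ultimately obtain j
      where j: "j < s + t" "pos (p x) = U B j" "pos (p (f x)) = U B (next_pos s t j)"
      by blast
    have "inj_on (U B) {..<s + t}" using U[OF B(1)] by (simp add: balloon_enum_def)
    then have "j = k" using j(1,2) B(2) by (simp add: Bk pos_def inj_on_eq_iff)
    then have "pos (p (f x)) = pos (balloon_step s t (p x))"
      using j(3) by (simp add: Bk pos_def balloon_step_def)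
    then show "f x \<in> pos (balloon_step s t (p x))" using p(2)[of "f x"] by simp
  qed
  have out: "\<exists>x. x \<notin> range f \<and> p x = d" if d: "d \<in> D" for d
  proof -
    have B: "fst d \<in> C" using d by (auto simp: D_def)
    have "\<exists>x\<in>pos d. x \<notin> range f"
    proof (rule strict_balloon_point_outside_range)
      show "strict_balloon f (fst d)" using comp B by (simp add: C_def G_def)
      show "pos d \<in> pverts (fst d)" by (rule pos_vert[OF d])
      show "pos d \<noteq> {}" using P'(2) posP[OF d] by metis
      fix y assume y: "f y \<in> pos d"
      obtain b where b: "b \<in> P" "y \<in> b" using cover by blast
      then have "(b, pos d) \<in> parcs G"
        unfolding G_def Gr_arc_iff by (intro conjI posP[OF d] b(1)) (use b(2) y in blast)
      then show "\<exists>b. y \<in> b \<and> (b, pos d) \<in> parcs (fst d)"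
        using arc_in[OF B] pos_vert[OF d] b(2) by blast
    qed
    then show ?thesis using pI[OF d] by blast
  qed
  have "balloon_coding f C s t p"
    unfolding balloon_coding_def
  proof (intro conjI ballI allI)
    show "range p \<subseteq> C \<times> {..<s + t}" using p(1) unfolding D_def by blast
    show "\<exists>x. x \<notin> range f \<and> p x = d" if "d \<in> C \<times> {..<s + t}" for d
      using that out unfolding D_def by simp
  qed (rule finC t lc step)+
  moreover have "\<exists>a\<in>P. x \<in> a \<and> y \<in> a" if "p x = p y" for x y
    using posP[OF p(1)[of x]] p(2)[of x] p(2)[of y] that by auto
  ultimately show ?thesis using that[of p] by (simp add: C_def G_def)
qed

text \<open>
  The defining property of the set for a single \<open>m\<close>. It is phrased by codings in
  \<open>balloon_maps_at_scale_I\<close>, with names of any type, and \<open>balloon_maps_at_scale_E\<close>.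
\<close>

definition balloon_maps_at_scale :: "nat \<Rightarrow> (cantor \<Rightarrow> cantor) set" where
  "balloon_maps_at_scale m = {f. continuous_on UNIV f \<and> (\<exists>P q. clopen_partition P \<and> mesh P < 1 / real m \<and>
        q \<ge> 1 \<and> m dvd q \<and> (\<forall>B. digraph_component (Gr f P) B \<longrightarrow>
           balloon (fact q) (fact q) B \<and> strict_balloon f B))}"

lemma strict_balloon_maps_eq: "strict_balloon_maps = (\<Inter>m\<in>{1..}. balloon_maps_at_scale m)"
  unfolding strict_balloon_maps_def balloon_maps_at_scale_def mspace_cantor_maps by fastforce

lemma balloon_maps_at_scale_I:
  assumes f: "continuous_on UNIV f" and m: "1 \<le> m" and q: "1 \<le> q" "m dvd q"
    and cod: "balloon_coding f C (fact q) (fact q) p"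
    and fine: "\<And>x y. p x = p y \<Longrightarrow> agree m x y"
  shows "f \<in> balloon_maps_at_scale m"
proof -
  let ?n = "fact q :: nat"
  define P where "P = (\<lambda>d. p -` {d}) ` (C \<times> {..<?n + ?n})"
  have P: "clopen_partition P" unfolding P_def by (rule fibres_clopen_partition[OF cod])
  have "mesh P < 1 / real m"
    unfolding mesh_less_iff[OF P m] using fine by (auto simp: P_def)
  moreover have "balloon ?n ?n B \<and> strict_balloon f B" if "digraph_component (Gr f P) B" for B
    using fibres_components[OF cod fact_ge_1] that unfolding P_def by blast
  ultimately show ?thesis unfolding balloon_maps_at_scale_def using f P q by blast
qed

lemma balloon_maps_at_scale_E:
  assumes "f \<in> balloon_maps_at_scale m" "1 \<le> m"
  obtains q p and C :: "cantor set pair_pre_digraph set"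
  where "1 \<le> q" "m dvd q" "balloon_coding f C (fact q) (fact q) p"
    "\<forall>x y. p x = p y \<longrightarrow> agree m x y"
proof -
  from assms(1) obtain P q where P: "clopen_partition P" "mesh P < 1 / real m" "1 \<le> q" "m dvd q"
    and comp: "\<And>B. digraph_component (Gr f P) B \<Longrightarrow> balloon (fact q) (fact q) B \<and> strict_balloon f B"
    unfolding balloon_maps_at_scale_def by blast
  obtain p where p: "balloon_coding f {B. digraph_component (Gr f P) B} (fact q) (fact q) p"
    "\<forall>x y. p x = p y \<longrightarrow> (\<exists>a\<in>P. x \<in> a \<and> y \<in> a)"
    by (rule partition_imp_coding[OF P(1) fact_ge_1 comp])
  have "agree m x y" if "p x = p y" for x y
    using p(2) that P(2) unfolding mesh_less_iff[OF P(1) assms(2)] by blast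
  with P(3,4) p(1) show ?thesis using that by blast
qed

section \<open>Genericity\<close>

text \<open>
  The coding of \<open>f\<close> itself works for all nearby \<open>g\<close>: \<open>p (g x) = p (f x)\<close> as soon as \<open>g x\<close> agrees
  with \<open>f x\<close> far enough, and the chosen points outside the range of \<open>f\<close>, one in each fibre, stay
  outside the range of \<open>g\<close>.
\<close>

lemma openness_at_scale:
  assumes "f \<in> balloon_maps_at_scale m" "1 \<le> m"
  obtains n where "\<And>g. continuous_on UNIV g \<Longrightarrow> (\<And>x. agree n (f x) (g x)) \<Longrightarrow> g \<in> balloon_maps_at_scale m"
proof -
  obtain q p and C :: "cantor set pair_pre_digraph set"
    where q: "1 \<le> q" "m dvd q" and cod: "balloon_coding f C (fact q) (fact q) p"
      and fine: "\<forall>x y. p x = p y \<longrightarrow> agree m x y"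
    by (rule balloon_maps_at_scale_E[OF assms]) (rule that)
  define D where "D = C \<times> {..<fact q + fact q :: nat}"
  have f: "continuous_on UNIV f" using assms(1) by (simp add: balloon_maps_at_scale_def)
  have fin: "finite D" and lc: "locally_constant p"
    using coding_finite[OF cod] coding_locally_constant[OF cod] by (simp_all add: D_def)
  have out: "\<exists>x. x \<notin> range f \<and> p x = d" if "d \<in> D" for d
    using coding_outside[OF cod] that unfolding D_def by blast
  have "\<exists>x n. p x = d \<and> (\<forall>z. agree n x z \<longrightarrow> z \<notin> range f)" if "d \<in> D" for d
    using out[OF that] outside_range_gap[OF f] by metis
  then obtain X N where X: "\<And>d. d \<in> D \<Longrightarrow> p (X d) = d"
    and N: "\<And>d z. d \<in> D \<Longrightarrow> agree (N d) (X d) z \<Longrightarrow> z \<notin> range f" by metis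
  obtain k where k: "\<And>x y. agree k x y \<Longrightarrow> p x = p y" using lc unfolding locally_constant_def by blast
  define n where "n = Max (insert k (N ` D))"
  have kn: "k \<le> n" and Nn: "\<And>d. d \<in> D \<Longrightarrow> N d \<le> n" using fin by (auto simp: n_def)
  have "g \<in> balloon_maps_at_scale m" if g: "continuous_on UNIV g" "\<And>x. agree n (f x) (g x)" for g
  proof (rule balloon_maps_at_scale_I[OF g(1) assms(2) q])
    have "X d \<notin> range g" if d: "d \<in> D" for d
    proof
      assume "X d \<in> range g"
      then obtain y where "X d = g y" by blast
      then have "agree n (X d) (f y)" using g(2)[of y] agree_sym by metis
      then have "agree (N d) (X d) (f y)" using Nn[OF d] by (rule agree_mono)
      then show False using N[OF d] by blast
    qed
    then have "\<exists>x. x \<notin> range g \<and> p x = d" if "d \<in> D" for d using X that by blast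
    moreover have "p (g x) = p (f x)" for x
      using k[OF agree_mono[OF g(2) kn]] by simp
    ultimately show "balloon_coding g C (fact q) (fact q) p"
      using cod unfolding balloon_coding_def D_def by simp
    show "agree m x y" if "p x = p y" for x y using fine that by blast
  qed
  then show ?thesis using that by blast
qed

text \<open>
  Among the first \<open>card R + 1\<close> iterates two coincide, so the preperiod and the period are at most
  \<open>q\<close>; hence the preperiod is at most \<open>q!\<close> and the period divides \<open>q!\<close>.
\<close>

lemma funpow_fact_periodic:
  assumes "finite R" "\<psi> ` R \<subseteq> R" "a \<in> R" "card R \<le> q"
  shows "(\<psi> ^^ (fact q + fact q)) a = (\<psi> ^^ fact q) a"
proof -
  have inR: "(\<psi> ^^ k) a \<in> R" for k by (induction k) (use assms(2,3) in auto)
  have "\<not> inj_on (\<lambda>k. (\<psi> ^^ k) a) {..card R}"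
  proof
    assume "inj_on (\<lambda>k. (\<psi> ^^ k) a) {..card R}"
    then have "card {..card R} \<le> card R" using inR assms(1) by (intro card_inj_on_le) auto
    then show False by simp
  qed
  then obtain i j where ij: "i < j" "j \<le> card R" "(\<psi> ^^ i) a = (\<psi> ^^ j) a"
    unfolding inj_on_def by (metis atMost_iff linorder_neqE_nat)
  define l where "l = j - i"
  have period: "(\<psi> ^^ (n + l)) a = (\<psi> ^^ n) a" if "i \<le> n" for n
  proof -
    have "(\<psi> ^^ (n + l)) a = (\<psi> ^^ (n - i)) ((\<psi> ^^ j) a)"
      using that ij(1) by (simp add: l_def flip: funpow_add comp_apply[of "\<psi> ^^ (n - i)"])
    also have "\<dots> = (\<psi> ^^ n) a"
      using that by (simp add: ij(3)[symmetric] flip: funpow_add comp_apply[of "\<psi> ^^ (n - i)"])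
    finally show ?thesis .
  qed
  have mult: "(\<psi> ^^ (n + c * l)) a = (\<psi> ^^ n) a" if "i \<le> n" for n c
  proof (induction c)
    case (Suc c)
    have "(\<psi> ^^ (n + Suc c * l)) a = (\<psi> ^^ ((n + c * l) + l)) a" by (simp add: algebra_simps)
    also have "\<dots> = (\<psi> ^^ (n + c * l)) a" using that by (intro period) simp
    finally show ?case using Suc by simp
  qed simp
  have "1 \<le> l" "l \<le> q" using ij assms(4) by (auto simp: l_def)
  then have "l dvd fact q" by (rule dvd_fact)
  then obtain c where c: "fact q = c * l" by (metis dvd_def mult.commute)
  have "i \<le> fact q" using ij assms(4) fact_ge_self[of q] by linarith
  from mult[OF this, of c] show ?thesis unfolding c[symmetric] .
qed

lemma locally_constant_imp_continuous: "locally_constant g \<Longrightarrow> continuous_on UNIV g"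
  for g :: "cantor \<Rightarrow> cantor"
  unfolding continuous_iff_agree locally_constant_def by (metis agree_refl)

text \<open>
  With \<open>\<psi>\<close> the map induced by \<open>f\<close> on cylinders of length \<open>K\<close>, each cylinder \<open>a\<close> gets a balloon
  whose \<open>k\<close>-th vertex is a piece of the cylinder \<open>\<psi>\<^sup>k a\<close>. All pieces that
  lie in the same cylinder are separated by the coordinates from \<open>K\<close> on. The approximating \<open>g\<close> sends
  each piece to one point of the next piece.
\<close>

lemma density_at_scale:
  assumes f: "continuous_on UNIV f" and m: "1 \<le> m"
  obtains g where "g \<in> balloon_maps_at_scale m" "\<And>x. agree n (f x) (g x)"
proof -
  define L where "L = n + m"
  obtain k where k: "\<And>x y. agree k x y \<Longrightarrow> agree L (f x) (f y)"
    using f unfolding continuous_iff_agree by metis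
  define K where "K = k + L"
  define trunc :: "cantor \<Rightarrow> cantor" where "trunc x = (\<lambda>i. i < K \<and> x i)" for x
  define R where "R = range trunc"
  have trunc_eq: "trunc x = trunc y \<longleftrightarrow> agree K x y" for x y
    unfolding trunc_def agree_def fun_eq_iff by blast
  have trunc_agree: "agree K x (trunc x)" for x by (simp add: trunc_def agree_def)
  have truncR: "trunc r = r" if "r \<in> R" for r
    using that by (auto simp: R_def trunc_def)
  have "R \<subseteq> (\<lambda>A i. i \<in> A) ` Pow {..<K}"
  proof
    fix r assume "r \<in> R"
    then have "r = (\<lambda>i. i \<in> {i. i < K \<and> r i})" using truncR unfolding trunc_def by force
    then show "r \<in> (\<lambda>A i. i \<in> A) ` Pow {..<K}" by blast
  qed
  then have finR: "finite R" using finite_subset by blast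
  have neR: "R \<noteq> {}" by (simp add: R_def)
  define \<psi> where "\<psi> r = trunc (f r)" for r
  have \<psi>R: "\<psi> r \<in> R" for r by (simp add: \<psi>_def R_def)
  \<comment> \<open>A multiple of \<open>m\<close> that is at least the number of cylinders, so that \<open>q!\<close> bounds all
    preperiods and is a multiple of all periods of \<open>\<psi>\<close>.\<close>
  define q where "q = m * card R"
  have cR: "1 \<le> card R" using finR neR by (simp add: Suc_leI card_gt_0_iff)
  have q: "1 \<le> q" "m dvd q" "card R \<le> q" using m cR by (auto simp: q_def)
  define s :: nat where "s = fact q"
  have s1: "1 \<le> s" by (simp add: s_def)
  have per: "(\<psi> ^^ (s + s)) a = (\<psi> ^^ s) a" if "a \<in> R" for a
    unfolding s_def by (rule funpow_fact_periodic[OF finR _ that q(3)]) (use \<psi>R in blast)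
  define D where "D = R \<times> {..<s + s}"
  \<comment> \<open>The cylinder that contains the piece with code \<open>d\<close>.\<close>
  define val where "val d = (\<psi> ^^ snd d) (fst d)" for d :: "cantor \<times> nat"
  have finD: "finite D" using finR by (simp add: D_def)
  have stepD: "balloon_step s s d \<in> D" if "d \<in> D" for d
    using that unfolding D_def by (rule balloon_step_in[OF s1])
  have val_step: "val (balloon_step s s d) = \<psi> (val d)" if "d \<in> D" for d
  proof (cases "Suc (snd d) < s + s")
    case True then show ?thesis by (simp add: val_def balloon_step_def next_pos_def)
  next
    case False
    then have e: "s + s = Suc (snd d)" and a: "fst d \<in> R" using that by (auto simp: D_def)
    have "val (balloon_step s s d) = (\<psi> ^^ s) (fst d)"
      using False by (simp add: val_def balloon_step_def next_pos_def)
    also have "\<dots> = (\<psi> ^^ Suc (snd d)) (fst d)" using per[OF a] unfolding e by simp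
    finally show ?thesis by (simp add: val_def)
  qed
  have valR: "val d \<in> R" if "d \<in> D" for d
  proof (cases "snd d")
    case 0 then show ?thesis using that by (auto simp: val_def D_def)
  next
    case (Suc j) then show ?thesis using \<psi>R by (simp add: val_def)
  qed
  \<comment> \<open>The codes of the pieces of the cylinder \<open>b\<close>, and a bound on their number that does not
    depend on \<open>b\<close>.\<close>
  define E where "E b = {d \<in> D. val d = b}" for b
  define N where "N = card D"
  have finE: "finite (E b)" for b using finD by (simp add: E_def)
  have neE: "E (trunc x) \<noteq> {}" for x
  proof -
    have "(trunc x, 0) \<in> E (trunc x)" using s1 by (simp add: E_def D_def val_def R_def)
    then show ?thesis by blast
  qed
  \<comment> \<open>The number of zeros that follow the first \<open>K\<close> digits, cut off at \<open>N\<close>: it takes each of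
    the values below \<open>N\<close> on every cylinder, and selects a piece.\<close>
  define tail where "tail x = (LEAST j. j = N \<or> (j < N \<and> x (K + j)))" for x :: cantor
  define p where "p x = from_nat_into (E (trunc x)) (tail x)" for x
  have pE: "p x \<in> E (trunc x)" for x unfolding p_def by (rule from_nat_into[OF neE])
  have pD: "p x \<in> D" and val_p: "val (p x) = trunc x" for x using pE[of x] by (simp_all add: E_def)
  have two: "\<exists>x y. x \<noteq> y \<and> p x = d \<and> p y = d" if d: "d \<in> D" for d
  proof -
    define b where "b = val d"
    define j where "j = to_nat_on (E b) d"
    have dE: "d \<in> E b" using d by (simp add: E_def b_def)
    have "j \<in> {..<card (E b)}"
      unfolding j_def using to_nat_on_finite[OF finE] dE by (rule bij_betwE[rule_format])
    moreover have "card (E b) \<le> N" unfolding N_def E_def using finD by (intro card_mono) auto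
    ultimately have j: "j < N" by simp
    \<comment> \<open>Digits beyond the first one after the zeros do not influence the code, so each
      piece has two different points.\<close>
    define X where "X v = (\<lambda>i. if i < K then b i else if i < K + j then False
      else if i = K + j then True else v)" for v :: bool
    have "p (X v) = d" for v
    proof -
      have "trunc (X v) = trunc b" by (auto simp: trunc_eq agree_def X_def)
      then have tr: "trunc (X v) = b" using truncR valR[OF d] by (simp add: b_def)
      have "tail (X v) = j" unfolding tail_def
      proof (rule Least_equality)
        show "j = N \<or> (j < N \<and> X v (K + j))" using j by (simp add: X_def)
        show "j \<le> i" if "i = N \<or> (i < N \<and> X v (K + i))" for i
          using that j by (auto simp: X_def split: if_splits)
      qed
      then show ?thesis unfolding p_def tr j_def
        using from_nat_into_to_nat_on[OF countable_finite[OF finE] dE] by simp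
    qed
    moreover have "X True (K + j + 1) \<noteq> X False (K + j + 1)" by (simp add: X_def)
    then have "X True \<noteq> X False" by metis
    ultimately show ?thesis by blast
  qed
  have lc: "locally_constant p" unfolding locally_constant_def
  proof (intro exI allI impI)
    fix x y assume a: "agree (K + N) x y"
    have "agree K x y" using a by (rule agree_mono) simp
    then have tr: "trunc x = trunc y" by (simp add: trunc_eq)
    have "j = N \<or> (j < N \<and> x (K + j)) \<longleftrightarrow> j = N \<or> (j < N \<and> y (K + j))" for j
      using a by (auto simp: agree_def)
    then have "tail x = tail y" by (simp add: tail_def)
    with tr show "p x = p y" by (simp add: p_def)
  qed
  have "\<exists>x. p x = d" if "d \<in> D" for d using two[OF that] by blast
  then obtain pt where pt: "\<And>d. d \<in> D \<Longrightarrow> p (pt d) = d" by metis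
  \<comment> \<open>\<open>g\<close> takes only one value in each piece, so the second point of the piece is outside
    its range.\<close>
  define g where "g x = pt (balloon_step s s (p x))" for x
  have pg: "p (g x) = balloon_step s s (p x)" for x
    unfolding g_def by (rule pt[OF stepD[OF pD]])
  have g: "continuous_on UNIV g"
    unfolding g_def by (rule locally_constant_imp_continuous[OF locally_constant_comp[OF lc]])
  have out: "\<exists>x. x \<notin> range g \<and> p x = d" if d: "d \<in> D" for d
  proof -
    obtain x y where xy: "x \<noteq> y" "p x = d" "p y = d" using two[OF d] by blast
    have "z = pt d" if "z \<in> range g" "p z = d" for z
      using that pg by (auto simp: g_def)
    then show ?thesis using xy by metis
  qed
  have "balloon_coding g R s s p"
    unfolding balloon_coding_def
  proof (intro conjI ballI allI)
    show "range p \<subseteq> R \<times> {..<s + s}" using pD by (auto simp: D_def[symmetric] simp del: mem_Sigma_iff)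
    show "\<exists>x. x \<notin> range g \<and> p x = d" if "d \<in> R \<times> {..<s + s}" for d
      using that out unfolding D_def by simp
  qed (rule finR s1 lc pg)+
  moreover have "agree m x y" if "p x = p y" for x y
  proof -
    have "trunc x = trunc y" using val_p that by metis
    then show ?thesis unfolding trunc_eq by (rule agree_mono) (simp add: K_def L_def)
  qed
  ultimately have "g \<in> balloon_maps_at_scale m"
    using balloon_maps_at_scale_I[OF g m q(1,2), of R p] by (simp add: s_def)
  moreover have "agree n (f x) (g x)" for x
  proof -
    have "trunc (g x) = \<psi> (trunc x)"
      using val_p[of "g x"] unfolding pg val_step[OF pD] val_p by (rule sym)
    then have "agree K (g x) (f (trunc x))" by (simp add: \<psi>_def trunc_eq)
    then have "agree K (f (trunc x)) (g x)" by (rule agree_sym)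
    then have "agree n (f (trunc x)) (g x)" by (rule agree_mono) (simp add: K_def L_def)
    moreover have "agree L (f x) (f (trunc x))"
      by (rule k[OF agree_mono[OF trunc_agree]]) (simp add: K_def)
    then have "agree n (f x) (f (trunc x))" by (rule agree_mono) (simp add: L_def)
    ultimately show ?thesis using agree_trans by blast
  qed
  ultimately show ?thesis by (rule that)
qed

text \<open>
  The uniform metric on maps, again in terms of agreement.
\<close>

lemma openin_cantor_maps_iff:
  "openin (mtopology_of cantor_maps) U \<longleftrightarrow> U \<subseteq> {f. continuous_on UNIV f} \<and>
     (\<forall>f\<in>U. \<exists>n. \<forall>g. continuous_on UNIV g \<longrightarrow> (\<forall>x. agree n (f x) (g x)) \<longrightarrow> g \<in> U)"
proof -
  interpret M: Metric_space "{f. continuous_on UNIV f}" "mdist cantor_maps"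
    using Metric_space_mspace_mdist[of cantor_maps] by (simp add: mspace_cantor_maps)
  have top: "mtopology_of cantor_maps = M.mtopology"
    by (simp add: mtopology_of_def mspace_cantor_maps)
  have "(\<exists>r>0. M.mball f r \<subseteq> U) \<longleftrightarrow>
      (\<exists>n. \<forall>g. continuous_on UNIV g \<longrightarrow> (\<forall>x. agree n (f x) (g x)) \<longrightarrow> g \<in> U)"
    if f: "continuous_on UNIV f" for f
  proof
    assume "\<exists>r>0. M.mball f r \<subseteq> U"
    then obtain r where r: "0 < r" "M.mball f r \<subseteq> U" by blast
    obtain n where n: "1 / real (Suc n) < r" using nat_approx_posE[OF r(1)] .
    have "g \<in> U" if "continuous_on UNIV g" "\<forall>x. agree (Suc n) (f x) (g x)" for g
    proof -
      have "mdist cantor_maps f g < r"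
        using cantor_maps_dist_less[of n f g] that(2) n by (meson less_trans)
      then show ?thesis using r(2) f that(1) by auto
    qed
    then show "\<exists>n. \<forall>g. continuous_on UNIV g \<longrightarrow> (\<forall>x. agree n (f x) (g x)) \<longrightarrow> g \<in> U" by blast
  next
    assume "\<exists>n. \<forall>g. continuous_on UNIV g \<longrightarrow> (\<forall>x. agree n (f x) (g x)) \<longrightarrow> g \<in> U"
    then obtain n where n: "\<And>g. continuous_on UNIV g \<Longrightarrow> (\<And>x. agree n (f x) (g x)) \<Longrightarrow> g \<in> U"
      by blast
    have "M.mball f (1 / real (Suc n)) \<subseteq> U"
    proof
      fix g assume "g \<in> M.mball f (1 / real (Suc n))"
      then have g: "continuous_on UNIV g" "mdist cantor_maps f g < 1 / real (Suc n)" by auto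
      have "agree n (f x) (g x)" for x
        using cantor_maps_dist_lessD[OF g(2)] by (rule agree_mono) simp
      then show "g \<in> U" using n[OF g(1)] by blast
    qed
    then show "\<exists>r>0. M.mball f r \<subseteq> U" by (intro exI[of _ "1 / real (Suc n)"]) auto
  qed
  then show ?thesis unfolding top M.openin_mtopology by blast
qed

text \<open>
  The complement is the union, over all scales, of the complements of open dense sets.
\<close>

lemma comeager_strict_balloon_maps: "comeager_in (mtopology_of cantor_maps) strict_balloon_maps"
proof -
  let ?T = "mtopology_of cantor_maps" and ?X = "{f :: cantor \<Rightarrow> cantor. continuous_on UNIV f}"
  have top: "topspace ?T = ?X" by (simp add: mspace_cantor_maps)
  have sub: "balloon_maps_at_scale m \<subseteq> ?X" for m by (auto simp: balloon_maps_at_scale_def)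
  have opn: "openin ?T (balloon_maps_at_scale m)" if "1 \<le> m" for m
    unfolding openin_cantor_maps_iff using sub openness_at_scale[OF _ that] by (metis (no_types))
  have nd: "nowhere_dense_in ?T (?X - balloon_maps_at_scale m)" if m: "1 \<le> m" for m
  proof -
    have "?T closure_of (?X - balloon_maps_at_scale m) = ?X - balloon_maps_at_scale m"
      unfolding closure_of_eq top[symmetric] by (rule closedin_diff[OF closedin_topspace opn[OF m]])
    moreover have "T = {}" if T: "openin ?T T" "T \<subseteq> ?X - balloon_maps_at_scale m" for T
    proof (rule ccontr)
      assume "T \<noteq> {}"
      then obtain f where f: "f \<in> T" by blast
      obtain n where n: "\<And>g. continuous_on UNIV g \<Longrightarrow> (\<forall>x. agree n (f x) (g x)) \<Longrightarrow> g \<in> T"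
        using T(1) f unfolding openin_cantor_maps_iff by blast
      have "continuous_on UNIV f" using T(2) f by blast
      then obtain g where g: "g \<in> balloon_maps_at_scale m" "\<And>x. agree n (f x) (g x)"
        using density_at_scale[OF _ m] by metis
      then have "g \<in> T" using n sub by blast
      then show False using T(2) g(1) by blast
    qed
    ultimately show ?thesis
      unfolding nowhere_dense_in_def top interior_of_def by auto
  qed
  have "strict_balloon_maps \<subseteq> ?X" using sub[of 1] unfolding strict_balloon_maps_eq by auto
  moreover have "meager_in ?T (?X - strict_balloon_maps)"
    unfolding meager_in_def strict_balloon_maps_eq
    by (rule exI[of _ "(\<lambda>m. ?X - balloon_maps_at_scale m) ` {1..}"]) (use nd in auto)
  ultimately show ?thesis unfolding comeager_in_def top by simp
qed

section \<open>Refining the codings of two maps simultaneously\<close>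

lemma funpow_balloon_step:
  assumes "1 \<le> t"
  shows "(balloon_step s t ^^ n) (c, 0) = (c, if n < s then n else s + (n - s) mod t)"
proof (induction n)
  case (Suc n)
  show ?case
  proof (cases "n < s")
    case True
    then show ?thesis using Suc assms by (auto simp: balloon_step_def next_pos_def)
  next
    case False
    then have e: "Suc n - s = Suc (n - s)" by simp
    have "(n - s) mod t < t" using assms by simp
    then show ?thesis using Suc False unfolding e
      by (auto simp: balloon_step_def next_pos_def mod_Suc)
  qed
qed (use assms in auto)

lemma funpow_balloon_step_less:
  assumes "1 \<le> t" "n < s + t"
  shows "(balloon_step s t ^^ n) (c, 0) = (c, n)"
  using assms by (simp add: funpow_balloon_step)

lemma funpow_balloon_step_periodic:
  assumes "1 \<le> t" "s \<le> n" "t dvd k"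
  shows "(balloon_step s t ^^ (n + k)) (c, 0) = (balloon_step s t ^^ n) (c, 0)"
proof -
  have "(n + k - s) mod t = (n - s) mod t"
    using assms by (metis Nat.add_diff_assoc2 mod_add_right_eq dvd_eq_mod_eq_0 add.right_neutral)
  then show ?thesis using assms by (simp add: funpow_balloon_step)
qed

lemma funpow_balloon_step_in:
  assumes "1 \<le> t" "c \<in> C"
  shows "(balloon_step s t ^^ n) (c, 0) \<in> C \<times> {..<s + t}"
  using assms by (simp add: funpow_balloon_step)

text \<open>
  A balloon mapped into a coarser one is determined by the image of its first vertex. The factor
  map \<open>\<theta>\<close> commutes with the steps because both codings intertwine them with \<open>f\<close> and the fine
  coding attains every code.
\<close>

lemma factor_funpow_balloon_step:
  assumes cod': "balloon_coding f C' s' t' p'" and cod: "balloon_coding f C s t p"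
    and p: "p = \<theta> \<circ> p'" and c: "c \<in> C'"
  shows "\<theta> ((balloon_step s' t' ^^ n) (c, 0)) = (balloon_step s t ^^ n) (\<theta> (c, 0))"
proof (induction n)
  case (Suc n)
  let ?d = "(balloon_step s' t' ^^ n) (c, 0)"
  have t': "1 \<le> t'" by (rule coding_cycle[OF cod'])
  have "?d \<in> C' \<times> {..<s' + t'}" by (rule funpow_balloon_step_in[OF t' c])
  from coding_onto[OF cod' this] obtain x where x: "p' x = ?d" ..
  have "\<theta> (balloon_step s' t' ?d) = p (f x)" using coding_step[OF cod', of x] by (simp add: p x)
  also have "\<dots> = balloon_step s t (\<theta> ?d)" using coding_step[OF cod, of x] by (simp add: p x)
  finally show ?case using Suc by simp
qed simp

text \<open>
  Choose \<open>M\<close> points outside the range of \<open>f\<close> in every fibre of \<open>p\<close>; there are that many, since such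
  points form a nonempty open set. In a fine enough coding \<open>p'\<close> these points have different codes,
  and the fibre of each of them is disjoint from the range of \<open>f\<close>. But a fibre in a position \<open>k + 1\<close>
  meets the range, so the points are all in position \<open>0\<close> and their names are different.
  Prescribing a divisor \<open>q\<^sub>0\<close> of \<open>q\<close> makes the lengths \<open>q\<^sub>0!\<close> and \<open>q!\<close> compatible.
\<close>

lemma refine_coding:
  assumes f: "f \<in> strict_balloon_maps" and cod: "balloon_coding f C s t p" and q0: "1 \<le> q\<^sub>0"
  obtains q p' \<theta> and C' :: "cantor set pair_pre_digraph set"
  where "1 \<le> q" "q\<^sub>0 dvd q" "balloon_coding f C' (fact q) (fact q) p'"
    "\<forall>x y. p' x = p' y \<longrightarrow> agree N x y" "p = \<theta> \<circ> p'"
    "\<forall>d\<in>C \<times> {..<s + t}. M \<le> card {c \<in> C'. \<theta> (c, 0) = d}"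
proof -
  define D where "D = C \<times> {..<s + t}"
  have fc: "continuous_on UNIV f"
    using f by (simp add: strict_balloon_maps_def mspace_cantor_maps)
  have finD: "finite D" and lc: "locally_constant p"
    and out: "\<And>d. d \<in> D \<Longrightarrow> \<exists>x. x \<notin> range f \<and> p x = d"
    using coding_finite[OF cod] coding_locally_constant[OF cod] coding_outside[OF cod]
    by (simp_all add: D_def)
  have "\<exists>F. F \<subseteq> p -` {d} - range f \<and> finite F \<and> card F = M" if d: "d \<in> D" for d
  proof -
    have "open (p -` {d} - range f)"
      unfolding open_iff_agree
    proof
      fix x assume x: "x \<in> p -` {d} - range f"
      obtain n where n: "\<And>z. agree n x z \<Longrightarrow> z \<notin> range f"
        using outside_range_gap[OF fc, of x] x by blast
      obtain k where k: "\<And>x y. agree k x y \<Longrightarrow> p x = p y" using lc unfolding locally_constant_def by blast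
      have "y \<in> p -` {d} - range f" if "agree (max n k) x y" for y
      proof -
        have "agree n x y" "agree k x y"
          using that agree_mono by (meson max.cobounded1 max.cobounded2)+
        then show ?thesis using n[of y] k[of x y] x by simp
      qed
      then show "\<exists>n. \<forall>y. agree n x y \<longrightarrow> y \<in> p -` {d} - range f" by blast
    qed
    moreover have "p -` {d} - range f \<noteq> {}" using out[OF d] by blast
    ultimately have "infinite (p -` {d} - range f)" by (rule open_infinite)
    from infinite_arbitrarily_large[OF this, of M] show ?thesis by auto
  qed
  then have "\<forall>d\<in>D. \<exists>F. F \<subseteq> p -` {d} - range f \<and> finite F \<and> card F = M" by (rule ballI)
  from bchoice[OF this] obtain F
    where "\<forall>d\<in>D. F d \<subseteq> p -` {d} - range f \<and> finite (F d) \<and> card (F d) = M" ..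
  then have F: "F d \<subseteq> p -` {d} - range f" "finite (F d)" "card (F d) = M" if "d \<in> D" for d
    using that by simp_all
  define A where "A = (\<Union>d\<in>D. F d)"
  have finA: "finite A" using finD F(2) by (simp add: A_def)
  have Aout: "x \<notin> range f" if "x \<in> A" for x using that F(1) unfolding A_def by blast
  have "\<exists>n. \<forall>z. agree n x z \<longrightarrow> z \<notin> range f" if "x \<in> A" for x
    using outside_range_gap[OF fc Aout[OF that]] by blast
  then obtain G where G: "\<And>x z. x \<in> A \<Longrightarrow> agree (G x) x z \<Longrightarrow> z \<notin> range f" by metis
  obtain n2 where n2: "\<And>x y. x \<in> A \<Longrightarrow> y \<in> A \<Longrightarrow> agree n2 x y \<Longrightarrow> x = y"
    using separate_finite[OF finA] by blast
  obtain n3 where n3: "\<And>x y. agree n3 x y \<Longrightarrow> p x = p y" using lc unfolding locally_constant_def by blast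
  define n1 where "n1 = Max (insert 0 (G ` A))"
  have n1: "G x \<le> n1" if "x \<in> A" for x using that finA by (simp add: n1_def)
  \<comment> \<open>Agreement on \<open>l\<close> coordinates keeps points of \<open>A\<close> apart (\<open>n2\<close>) and their neighbours
    outside the range (\<open>n1\<close>), determines \<open>p\<close> (\<open>n3\<close>), and gives the required fineness (\<open>N\<close>).\<close>
  define l where "l = Suc (n1 + n2 + n3 + N)"
  define m where "m = q\<^sub>0 * l"
  have "1 * l \<le> q\<^sub>0 * l" using q0 by (rule mult_le_mono1)
  then have m: "1 \<le> m" "l \<le> m" by (simp_all add: m_def l_def)
  have "f \<in> balloon_maps_at_scale m" using f m(1) unfolding strict_balloon_maps_eq by simp
  then obtain q p' and C' :: "cantor set pair_pre_digraph set"
    where q: "1 \<le> q" "m dvd q" and cod': "balloon_coding f C' (fact q) (fact q) p'"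
      and fine: "\<forall>x y. p' x = p' y \<longrightarrow> agree m x y"
    by (rule balloon_maps_at_scale_E[OF _ m(1)]) (rule that)
  have fine': "agree j x y" if "p' x = p' y" "j \<le> l" for x y j
    using fine that m(2) by (meson agree_mono order_trans)
  have "\<forall>x y. p' x = p' y \<longrightarrow> p x = p y"
    using n3 fine'[of _ _ n3] by (simp add: l_def)
  then obtain \<theta> where \<theta>: "p = \<theta> \<circ> p'" unfolding function_factors_left by blast
  have start: "snd (p' x) = 0" if x: "x \<in> A" for x
  proof (rule ccontr)
    assume "snd (p' x) \<noteq> 0"
    then obtain c j where cj: "p' x = (c, Suc j)" by (metis not0_implies_Suc prod.collapse)
    have "p' x \<in> C' \<times> {..<fact q + fact q}" by (rule coding_in[OF cod'])
    then have "(c, j) \<in> C' \<times> {..<fact q + fact q}" "Suc j < fact q + fact q" using cj by auto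
    then obtain y where y: "p' y = (c, j)" using coding_onto[OF cod'] by metis
    have "p' (f y) = balloon_step (fact q) (fact q) (p' y)" by (rule coding_step[OF cod'])
    then have "p' (f y) = p' x"
      using \<open>Suc j < _\<close> by (simp add: y cj balloon_step_def next_pos_def)
    then have "agree (G x) x (f y)"
      using n1[OF x] by (intro fine') (auto simp: l_def)
    then show False using G[OF x] by blast
  qed
  have "M \<le> card {c \<in> C'. \<theta> (c, 0) = d}" if d: "d \<in> D" for d
  proof -
    have p'0: "p' x = (fst (p' x), 0)" if "x \<in> F d" for x
      using start[of x] that d by (auto simp: A_def prod_eq_iff)
    have "card (F d) \<le> card {c \<in> C'. \<theta> (c, 0) = d}"
    proof (rule card_inj_on_le)
      show "inj_on (\<lambda>x. fst (p' x)) (F d)"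
      proof (rule inj_onI)
        fix x y assume xy: "x \<in> F d" "y \<in> F d" "fst (p' x) = fst (p' y)"
        then have "p' x = p' y" using p'0 by metis
        then have "agree n2 x y" by (rule fine') (simp add: l_def)
        then show "x = y" using n2 xy(1,2) d unfolding A_def by blast
      qed
      show "(\<lambda>x. fst (p' x)) ` F d \<subseteq> {c \<in> C'. \<theta> (c, 0) = d}"
      proof (intro image_subsetI CollectI conjI)
        fix x assume x: "x \<in> F d"
        have "p' x \<in> C' \<times> {..<fact q + fact q}" by (rule coding_in[OF cod'])
        then show "fst (p' x) \<in> C'" by auto
        have "p x = d" using F(1)[OF d] x by blast
        then show "\<theta> (fst (p' x), 0) = d" using p'0[OF x] unfolding \<theta> by simp
      qed
      show "finite {c \<in> C'. \<theta> (c, 0) = d}" using coding_finite[OF cod'] by simp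
    qed
    then show ?thesis using F(3)[OF d] by simp
  qed
  then have many: "\<forall>d\<in>C \<times> {..<s + t}. M \<le> card {c \<in> C'. \<theta> (c, 0) = d}"
    unfolding D_def by (rule ballI)
  have dvd: "q\<^sub>0 dvd q" using q(2) unfolding m_def by (rule dvd_mult_left)
  have "agree N x y" if "p' x = p' y" for x y using that by (rule fine') (simp add: l_def)
  then have "\<forall>x y. p' x = p' y \<longrightarrow> agree N x y" by blast
  then show ?thesis by (rule that[OF q(1) dvd cod' _ \<theta> many])
qed

lemma surjection_of_card_le:
  assumes "finite A" "A \<noteq> {}" "card A \<le> card B"
  obtains \<tau> where "\<tau> ` B = A"
proof -
  have "card A \<noteq> 0" using assms by simp
  then have "finite B" using assms(3) by (metis card.infinite le_zero_eq)
  then obtain \<iota> where \<iota>: "\<iota> ` A \<subseteq> B" "inj_on \<iota> A" using card_le_inj[OF assms(1) _ assms(3)] by blast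
  obtain a where "a \<in> A" using assms(2) by blast
  define \<tau> where "\<tau> b = (if b \<in> \<iota> ` A then inv_into A \<iota> b else a)" for b
  have "\<tau> b \<in> A" for b using \<open>a \<in> A\<close> by (simp add: \<tau>_def inv_into_into)
  moreover have "\<tau> (\<iota> a) = a" if "a \<in> A" for a using that \<iota>(2) by (simp add: \<tau>_def)
  then have "A \<subseteq> \<tau> ` B" using \<iota>(1) by (metis image_eqI image_subset_iff subsetI)
  ultimately show ?thesis using that by blast
qed

text \<open>
  The coding of \<open>f\<close> is refined first. Then \<open>g\<close> gets a refinement by longer balloons, at least
  \<open>card C'\<close> of them over each starting place, so that its names can be mapped onto those for
  \<open>f\<close> by a map \<open>\<tau>\<close> that preserves starting places. Following \<open>\<tau>\<close> by iteration of the step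
  wraps each long balloon onto a short one: this is consistent at the end of the long cycle because
  its length is a multiple of the short one and the wrapping has entered the short cycle by then.
  Only the coding of \<open>f\<close> gets the prescribed fineness; that of \<open>g\<close> is coarsened by the
  wrapping and by \<open>\<tau>\<close>.
\<close>

lemma extend_codings:
  fixes p r :: "cantor \<Rightarrow> 'a \<times> nat"
  assumes f: "f \<in> strict_balloon_maps" and g: "g \<in> strict_balloon_maps"
    and codf: "balloon_coding f C s t p" and codg: "balloon_coding g C s t r"
  obtains s' t' \<theta> p' r' and C' :: "cantor set pair_pre_digraph set"
  where "balloon_coding f C' s' t' p'" "balloon_coding g C' s' t' r'"
    "p = \<theta> \<circ> p'" "r = \<theta> \<circ> r'" "\<forall>x y. p' x = p' y \<longrightarrow> agree N x y"
proof -
  obtain q p' \<theta> and C' :: "cantor set pair_pre_digraph set"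
    where q: "1 \<le> q" and cod': "balloon_coding f C' (fact q) (fact q) p'"
      and fine: "\<forall>x y. p' x = p' y \<longrightarrow> agree N x y" and \<theta>: "p = \<theta> \<circ> p'"
      and many: "\<forall>d\<in>C \<times> {..<s + t}. 1 \<le> card {c \<in> C'. \<theta> (c, 0) = d}"
    by (rule refine_coding[OF f codf order_refl, of N 1]) (rule that)
  obtain q2 r2 \<theta>2 and C2 :: "cantor set pair_pre_digraph set"
    where q2: "1 \<le> q2" "q dvd q2" and cod2: "balloon_coding g C2 (fact q2) (fact q2) r2"
      and \<theta>2: "r = \<theta>2 \<circ> r2"
      and many2: "\<forall>d\<in>C \<times> {..<s + t}. card C' \<le> card {c \<in> C2. \<theta>2 (c, 0) = d}"
    by (rule refine_coding[OF g codg q, of 0 "card C'"]) (rule that)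
  define u v :: nat where "u = fact q" and "v = fact q2"
  have "q \<le> q2" using q2 by (intro dvd_imp_le) auto
  then have uv: "u dvd v" "u \<le> v" by (simp_all add: u_def v_def fact_dvd fact_mono)
  have u1: "1 \<le> u" and v1: "1 \<le> v" by (simp_all add: u_def v_def)
  note cod' = cod'[folded u_def] and cod2 = cod2[folded v_def]
  have fin: "finite C'" by (rule coding_finite[OF cod'])
  have \<theta>_in: "\<theta> (c, 0) \<in> C \<times> {..<s + t}" if "c \<in> C'" for c
  proof -
    have "(c, 0) \<in> C' \<times> {..<u + u}" using that u1 by simp
    then obtain x where "p' x = (c, 0)" using coding_onto[OF cod'] by metis
    then have "p x = \<theta> (c, 0)" by (simp add: \<theta>)
    then show ?thesis using coding_in[OF codf, of x] by simp
  qed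
  have \<theta>2_in: "\<theta>2 (c, 0) \<in> C \<times> {..<s + t}" if "c \<in> C2" for c
  proof -
    have "(c, 0) \<in> C2 \<times> {..<v + v}" using that v1 by simp
    then obtain x where "r2 x = (c, 0)" using coding_onto[OF cod2] by metis
    then have "r x = \<theta>2 (c, 0)" by (simp add: \<theta>2)
    then show ?thesis using coding_in[OF codg, of x] by simp
  qed
  have "\<exists>\<tau>. \<tau> ` {c \<in> C2. \<theta>2 (c, 0) = d} = {c \<in> C'. \<theta> (c, 0) = d}" if d: "d \<in> C \<times> {..<s + t}" for d
  proof -
    have "card {c \<in> C'. \<theta> (c, 0) = d} \<le> card C'" using fin by (intro card_mono) auto
    also have "\<dots> \<le> card {c \<in> C2. \<theta>2 (c, 0) = d}" using many2 d by (rule bspec)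
    finally have "card {c \<in> C'. \<theta> (c, 0) = d} \<le> card {c \<in> C2. \<theta>2 (c, 0) = d}" .
    moreover have "{c \<in> C'. \<theta> (c, 0) = d} \<noteq> {}"
      using bspec[OF many d] by (metis card.empty not_one_le_zero)
    moreover have "finite {c \<in> C'. \<theta> (c, 0) = d}" using fin by simp
    ultimately obtain \<tau> where "\<tau> ` {c \<in> C2. \<theta>2 (c, 0) = d} = {c \<in> C'. \<theta> (c, 0) = d}"
      using surjection_of_card_le[of "{c \<in> C'. \<theta> (c, 0) = d}" "{c \<in> C2. \<theta>2 (c, 0) = d}"]
      by blast
    then show ?thesis by (intro exI)
  qed
  then have "\<forall>d\<in>C \<times> {..<s + t}. \<exists>\<tau>. \<tau> ` {c \<in> C2. \<theta>2 (c, 0) = d} = {c \<in> C'. \<theta> (c, 0) = d}"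
    by (rule ballI)
  from bchoice[OF this] obtain T
    where "\<forall>d\<in>C \<times> {..<s + t}. T d ` {c \<in> C2. \<theta>2 (c, 0) = d} = {c \<in> C'. \<theta> (c, 0) = d}" ..
  then have T: "T d ` {c \<in> C2. \<theta>2 (c, 0) = d} = {c \<in> C'. \<theta> (c, 0) = d}"
    if "d \<in> C \<times> {..<s + t}" for d using that by (rule bspec)
  define \<tau> where "\<tau> c = T (\<theta>2 (c, 0)) c" for c
  have \<tau>: "\<tau> c \<in> C'" "\<theta> (\<tau> c, 0) = \<theta>2 (c, 0)" if "c \<in> C2" for c
    using T[OF \<theta>2_in[OF that]] that unfolding \<tau>_def by blast+
  have \<tau>_surj: "\<exists>c\<in>C2. \<tau> c = j" if j: "j \<in> C'" for j
  proof -
    have "j \<in> T (\<theta> (j, 0)) ` {c \<in> C2. \<theta>2 (c, 0) = \<theta> (j, 0)}" using T[OF \<theta>_in[OF j]] j by blast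
    then obtain c where "c \<in> C2" "\<theta>2 (c, 0) = \<theta> (j, 0)" "j = T (\<theta> (j, 0)) c" by blast
    then show ?thesis by (intro bexI[of _ c]) (simp_all add: \<tau>_def)
  qed
  \<comment> \<open>On positions below \<open>u + u\<close> wrapping is the identity, so every code of the short balloons is
    attained outside the range of \<open>g\<close>.\<close>
  define wrap where "wrap d = (balloon_step u u ^^ snd d) (\<tau> (fst d), 0)" for d
  have r2_in: "r2 x \<in> C2 \<times> {..<v + v}" for x by (rule coding_in[OF cod2])
  have wrap_step: "wrap (balloon_step v v d) = balloon_step u u (wrap d)"
    if d: "d \<in> C2 \<times> {..<v + v}" for d
  proof (cases "Suc (snd d) < v + v")
    case True
    then show ?thesis by (simp add: wrap_def balloon_step_def next_pos_def)
  next
    case False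
    then have e: "Suc (snd d) = v + v" using d by auto
    have "balloon_step u u (wrap d) = (balloon_step u u ^^ Suc (snd d)) (\<tau> (fst d), 0)"
      by (simp add: wrap_def)
    also have "\<dots> = (balloon_step u u ^^ v) (\<tau> (fst d), 0)"
      unfolding e by (rule funpow_balloon_step_periodic[OF u1 uv(2,1)])
    also have "\<dots> = wrap (balloon_step v v d)"
      using False by (simp add: wrap_def balloon_step_def next_pos_def)
    finally show ?thesis by simp
  qed
  define r' where "r' x = wrap (r2 x)" for x
  have "balloon_coding g C' u u r'"
    unfolding balloon_coding_def
  proof (intro conjI ballI allI)
    show "locally_constant r'" unfolding r'_def
      by (rule locally_constant_comp[OF coding_locally_constant[OF cod2]])
    show "range r' \<subseteq> C' \<times> {..<u + u}"
    proof (intro image_subsetI)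
      fix x
      have "fst (r2 x) \<in> C2" using r2_in[of x] by auto
      then show "r' x \<in> C' \<times> {..<u + u}"
        unfolding r'_def wrap_def by (intro funpow_balloon_step_in[OF u1] \<tau>(1))
    qed
    show "r' (g x) = balloon_step u u (r' x)" for x
    proof -
      have "r2 (g x) = balloon_step v v (r2 x)" by (rule coding_step[OF cod2])
      then show ?thesis using wrap_step[OF r2_in[of x]] by (simp add: r'_def)
    qed
    show "\<exists>x. x \<notin> range g \<and> r' x = d" if d: "d \<in> C' \<times> {..<u + u}" for d
    proof -
      obtain j k where jk: "d = (j, k)" "j \<in> C'" "k < u + u" using d by auto
      obtain c where c: "c \<in> C2" "\<tau> c = j" using \<tau>_surj[OF jk(2)] by blast
      have "(c, k) \<in> C2 \<times> {..<v + v}" using c(1) jk(3) uv(2) by simp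
      then obtain x where x: "x \<notin> range g" "r2 x = (c, k)" using coding_outside[OF cod2] by metis
      have "r' x = d" using funpow_balloon_step_less[OF u1 jk(3)] by (simp add: r'_def wrap_def x c jk)
      then show ?thesis using x(1) by blast
    qed
  qed (rule fin u1)+
  moreover have "r = \<theta> \<circ> r'"
  proof
    fix x
    obtain c k where ck: "r2 x = (c, k)" "c \<in> C2" "k < v + v" using r2_in[of x] by auto
    have "r x = \<theta>2 (c, k)" by (simp add: \<theta>2 ck)
    also have "\<dots> = (balloon_step s t ^^ k) (\<theta>2 (c, 0))"
      using factor_funpow_balloon_step[OF cod2 codg \<theta>2 ck(2), of k]
      unfolding funpow_balloon_step_less[OF v1 ck(3)] .
    also have "\<dots> = (balloon_step s t ^^ k) (\<theta> (\<tau> c, 0))" using \<tau>(2)[OF ck(2)] by simp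
    also have "\<dots> = \<theta> ((balloon_step u u ^^ k) (\<tau> c, 0))"
      by (rule factor_funpow_balloon_step[OF cod' codf \<theta> \<tau>(1)[OF ck(2)], symmetric])
    also have "\<dots> = (\<theta> \<circ> r') x" by (simp add: r'_def wrap_def ck)
    finally show "r x = (\<theta> \<circ> r') x" .
  qed
  ultimately show ?thesis by (intro that[OF cod' _ \<theta> _ fine])
qed

section \<open>The conjugacy\<close>

text \<open>
  The nonempty sets \<open>{z. \<sigma> n z = \<pi> n x}\<close> decrease with \<open>n\<close> and shrink to a point, which is
  \<open>h x\<close>.
\<close>

lemma limit_of_codings:
  fixes \<pi> \<sigma> :: "nat \<Rightarrow> cantor \<Rightarrow> 'b"
  assumes lcp: "\<And>n. locally_constant (\<pi> n)" and lcs: "\<And>n. locally_constant (\<sigma> n)"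
    and ran: "\<And>n x. \<exists>y. \<sigma> n y = \<pi> n x"
    and ref: "\<And>n. \<exists>\<theta>. \<pi> n = \<theta> \<circ> \<pi> (Suc n) \<and> \<sigma> n = \<theta> \<circ> \<sigma> (Suc n)"
    and fine: "\<And>n x y. \<sigma> (Suc n) x = \<sigma> (Suc n) y \<Longrightarrow> agree n x y"
  obtains h where "continuous_on UNIV h" "\<And>n x. \<sigma> n (h x) = \<pi> n x"
proof -
  have down: "\<sigma> n y = \<pi> n x" if "\<sigma> N y = \<pi> N x" "n \<le> N" for n N x y
    using that(2,1)
  proof (induction rule: inc_induct)
    case (step k)
    then have "\<sigma> (Suc k) y = \<pi> (Suc k) x" by blast
    then show ?case using ref[of k] by auto
  qed
  have ex: "\<exists>z. \<forall>n. \<sigma> n z = \<pi> n x" for x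
  proof -
    have "\<forall>n. \<exists>y. \<sigma> n y = \<pi> n x" using ran by blast
    from choice[OF this] obtain Y where Y: "\<And>n. \<sigma> n (Y n) = \<pi> n x" by blast
    \<comment> \<open>The code at stage \<open>i + 2\<close> determines the coordinates below \<open>i + 1\<close>, so the \<open>i\<close>-th
      coordinate is the same in \<open>Y N\<close> for all \<open>N \<ge> i + 2\<close>.\<close>
    define z where "z i = Y (Suc (Suc i)) i" for i
    have zY: "agree n z (Y N)" if "Suc n \<le> N" for n N
      unfolding agree_def
    proof (intro allI impI)
      fix i assume i: "i < n"
      have "\<sigma> (Suc (Suc i)) (Y N) = \<pi> (Suc (Suc i)) x" using i that by (intro down[OF Y]) simp
      then have "\<sigma> (Suc (Suc i)) (Y (Suc (Suc i))) = \<sigma> (Suc (Suc i)) (Y N)" using Y by simp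
      from fine[OF this] show "z i = Y N i" by (simp add: agree_def z_def)
    qed
    have "\<sigma> n z = \<pi> n x" for n
    proof -
      obtain k where k: "\<And>x y. agree k x y \<Longrightarrow> \<sigma> n x = \<sigma> n y"
        using lcs[of n] unfolding locally_constant_def by blast
      define N where "N = max n (Suc k)"
      have "\<sigma> n z = \<sigma> n (Y N)" by (rule k[OF zY]) (simp add: N_def)
      also have "\<dots> = \<pi> n x" by (rule down[OF Y]) (simp add: N_def)
      finally show ?thesis .
    qed
    then show ?thesis by blast
  qed
  then obtain h where h: "\<And>n x. \<sigma> n (h x) = \<pi> n x" by metis
  have "continuous_on UNIV h"
    unfolding continuous_iff_agree
  proof
    fix n
    obtain k where k: "\<And>x y. agree k x y \<Longrightarrow> \<pi> (Suc n) x = \<pi> (Suc n) y"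
      using lcp[of "Suc n"] unfolding locally_constant_def by blast
    have "agree n (h x) (h y)" if "agree k x y" for x y
      using k[OF that] h by (intro fine) simp
    then show "\<exists>k. \<forall>x y. agree k x y \<longrightarrow> agree n (h x) (h y)" by blast
  qed
  then show ?thesis using h that by blast
qed

text \<open>
  The start of the construction. Its only content is that \<open>f\<close> is not surjective, which strictness
  at any scale implies.
\<close>

lemma trivial_coding:
  assumes "f \<in> strict_balloon_maps"
  shows "balloon_coding f {c} 0 1 (\<lambda>_. (c, 0))"
proof -
  have "f \<in> balloon_maps_at_scale 1" using assms unfolding strict_balloon_maps_eq by simp
  then obtain q p and C :: "cantor set pair_pre_digraph set"
    where cod: "balloon_coding f C (fact q) (fact q) p"
    by (rule balloon_maps_at_scale_E[OF _ order_refl]) (rule that)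
  have "\<exists>y. y \<notin> range f" using coding_outside[OF cod coding_in[OF cod]] by blast
  then show ?thesis
    by (auto simp: balloon_coding_def locally_constant_def balloon_step_def next_pos_def)
qed

type_synonym component_label = "cantor set pair_pre_digraph"

text \<open>
  A stage of the construction: the common names, the lengths of path and cycle, and the codings of
  the two maps.
\<close>

type_synonym coding_pair = "component_label set \<times> nat \<times> nat \<times>
  (cantor \<Rightarrow> component_label \<times> nat) \<times> (cantor \<Rightarrow> component_label \<times> nat)"

text \<open>
  The codings of \<open>f\<close> and \<open>g\<close> are refined in turn, each stage making first the one and then the
  other fine; both always have the same names and positions and are linked to the previous stage
  by the same factor map. The two limit maps are inverse to each other, because codes separate
  points, and they intertwine \<open>f\<close> and \<open>g\<close>, because the step of codes is the same for both.
\<close>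

lemma strict_balloon_maps_conjugate:
  assumes f: "f \<in> strict_balloon_maps" and g: "g \<in> strict_balloon_maps"
  obtains h h' where "homeomorphism UNIV UNIV h h'" "f = h' \<circ> g \<circ> h"
proof -
  let ?L = "undefined :: component_label"
  define common where "common S \<longleftrightarrow> (case S of (C, s, t, p, r) \<Rightarrow>
    balloon_coding f C s t p \<and> balloon_coding g C s t r)"
    for S :: coding_pair
  define fcode where "fcode S = fst (snd (snd (snd S)))"
    for S :: coding_pair
  define gcode where "gcode S = snd (snd (snd (snd S)))"
    for S :: coding_pair
  define finer where "finer n S S' \<longleftrightarrow>
    (\<exists>\<theta>. fcode S = \<theta> \<circ> fcode S' \<and> gcode S = \<theta> \<circ> gcode S') \<and>
    (\<forall>x y. fcode S' x = fcode S' y \<longrightarrow> agree n x y) \<and>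
    (\<forall>x y. gcode S' x = gcode S' y \<longrightarrow> agree n x y)" for n S S'
  have "\<exists>\<Sigma>. \<forall>n. common (\<Sigma> n) \<and> finer n (\<Sigma> n) (\<Sigma> (Suc n))"
  proof (rule dependent_nat_choice)
    have "common ({?L}, 0, 1, \<lambda>_. (?L, 0), \<lambda>_. (?L, 0))"
      unfolding common_def using trivial_coding[OF f, of ?L] trivial_coding[OF g, of ?L] by simp
    then show "\<exists>S. common S" by blast
  next
    fix S n assume "common S"
    then obtain C s t p r where S: "S = (C, s, t, p, r)"
      and cod: "balloon_coding f C s t p" "balloon_coding g C s t r"
      by (cases S) (auto simp: common_def)
    obtain s1 t1 \<theta>1 p1 r1 and C1 :: "cantor set pair_pre_digraph set"
      where 1: "balloon_coding f C1 s1 t1 p1" "balloon_coding g C1 s1 t1 r1"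
        "p = \<theta>1 \<circ> p1" "r = \<theta>1 \<circ> r1" "\<forall>x y. p1 x = p1 y \<longrightarrow> agree n x y"
      by (rule extend_codings[OF f g cod, of n]) (rule that)
    obtain s2 t2 \<theta>2 p2 r2 and C2 :: "cantor set pair_pre_digraph set"
      where 2: "balloon_coding g C2 s2 t2 r2" "balloon_coding f C2 s2 t2 p2"
        "r1 = \<theta>2 \<circ> r2" "p1 = \<theta>2 \<circ> p2" "\<forall>x y. r2 x = r2 y \<longrightarrow> agree n x y"
      by (rule extend_codings[OF g f 1(2,1), of n]) (rule that)
    have "common (C2, s2, t2, p2, r2)" using 2(1,2) by (simp add: common_def)
    moreover have "p = (\<theta>1 \<circ> \<theta>2) \<circ> p2" "r = (\<theta>1 \<circ> \<theta>2) \<circ> r2"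
      using 1(3,4) 2(3,4) by (simp_all add: comp_assoc)
    moreover have "agree n x y" if "p2 x = p2 y" for x y using 1(5) that 2(4) by simp
    ultimately show "\<exists>S'. common S' \<and> finer n S S'"
      unfolding finer_def fcode_def gcode_def S
      by (intro exI[of _ "(C2, s2, t2, p2, r2)"]) (use 2(5) in auto)
  qed
  then obtain \<Sigma> where \<Sigma>: "\<And>n. common (\<Sigma> n)" "\<And>n. finer n (\<Sigma> n) (\<Sigma> (Suc n))" by blast
  define \<pi> \<sigma> where "\<pi> n = fcode (\<Sigma> n)" and "\<sigma> n = gcode (\<Sigma> n)" for n
  have cod: "\<exists>C s t. balloon_coding f C s t (\<pi> n) \<and> balloon_coding g C s t (\<sigma> n)" for n
    using \<Sigma>(1)[of n] unfolding common_def \<pi>_def \<sigma>_def fcode_def gcode_def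
    by (cases "\<Sigma> n") auto
  have lc: "locally_constant (\<pi> n)" "locally_constant (\<sigma> n)" for n
    using cod[of n] by (auto simp: balloon_coding_def)
  have ran: "\<exists>y. \<sigma> n y = \<pi> n x" "\<exists>y. \<pi> n y = \<sigma> n x" for n x
  proof -
    obtain C s t where c: "balloon_coding f C s t (\<pi> n)" "balloon_coding g C s t (\<sigma> n)"
      using cod[of n] by blast
    show "\<exists>y. \<sigma> n y = \<pi> n x" by (rule coding_onto[OF c(2) coding_in[OF c(1)]])
    show "\<exists>y. \<pi> n y = \<sigma> n x" by (rule coding_onto[OF c(1) coding_in[OF c(2)]])
  qed
  have ref: "\<exists>\<theta>. \<pi> n = \<theta> \<circ> \<pi> (Suc n) \<and> \<sigma> n = \<theta> \<circ> \<sigma> (Suc n)" for n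
    using \<Sigma>(2)[of n] unfolding finer_def \<pi>_def \<sigma>_def by (rule conjunct1)
  have fine: "\<pi> (Suc n) x = \<pi> (Suc n) y \<Longrightarrow> agree n x y"
    "\<sigma> (Suc n) x = \<sigma> (Suc n) y \<Longrightarrow> agree n x y" for n x y
    using \<Sigma>(2)[of n] unfolding finer_def \<pi>_def \<sigma>_def by simp_all
  obtain h where h: "continuous_on UNIV h" "\<And>n x. \<sigma> n (h x) = \<pi> n x"
    using limit_of_codings[of \<pi> \<sigma>] lc ran(1) ref fine(2) by metis
  obtain h' where h': "continuous_on UNIV h'" "\<And>n x. \<pi> n (h' x) = \<sigma> n x"
    using limit_of_codings[of \<sigma> \<pi>] lc ran(2) ref fine(1) by metis
  have inv: "h' (h x) = x" "h (h' x) = x" for x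
    by (rule agree_all_imp_eq, rule fine, simp add: h h')+
  have conj: "h (f x) = g (h x)" for x
  proof (rule agree_all_imp_eq, rule fine(2))
    fix n
    obtain C s t where c: "balloon_coding f C s t (\<pi> (Suc n))" "balloon_coding g C s t (\<sigma> (Suc n))"
      using cod[of "Suc n"] by blast
    show "\<sigma> (Suc n) (h (f x)) = \<sigma> (Suc n) (g (h x))"
      by (simp add: h coding_step[OF c(1)] coding_step[OF c(2)])
  qed
  have "homeomorphism UNIV UNIV h h'"
    using h(1) h'(1) inv by (auto simp: homeomorphism_def) (metis rangeI)+
  moreover have "f = h' \<circ> g \<circ> h" using conj inv(1) by (metis (no_types, lifting) comp_apply ext)
  ultimately show ?thesis by (rule that)
qed

theorem theorem5p1:
  shows "comeager_in (mtopology_of cantor_maps) strict_balloon_maps \<and>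
    (\<forall>f\<in>strict_balloon_maps. \<forall>g\<in>strict_balloon_maps.
       \<exists>h h'. homeomorphism UNIV UNIV h h' \<and> f = h' \<circ> g \<circ> h)"
  using comeager_strict_balloon_maps strict_balloon_maps_conjugate by metis

end
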